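(* Let $X=\{X(\mu;t):\mu\in\overline\Omega,t\ge0\}$ be a non-degenerate exponential family of Lévy processes. Then $X$ is self-similar with Hurst exponent $H=1$ in the extended sense, i.e. there exists a function $f:\mathbb{R}_+\to\overline\Omega$ such that for all $c>0$ and $\mu\in\overline\Omega$ $$X(\mu+f(c);ct)\overset d= c\,[X(\mu;t)+tf(c)]\quad\text{for } t>0,$$ if and only if $X$ is a Hougaard family of Lévy processes $S_\infty(\mu,b;t)$ with $b\ne0$, i.e. an exponential family of Lévy processes with $\Omega=\mathbb{R}$ and variance function $V(\mu)=\sigma^2e^{b\mu}$, $\mu\in\mathbb{R}$, for some $\sigma^2>0$ and $b\neq0$.
   Context: The index set $\overline\Omega$ is an interval (possibly containing $\pm\infty$) with $\mathbb{R}_+\subseteq\overline\Omega$ and $c\,\overline\Omega\subseteq\overline\Omega$ for $c>0$; $\Omega$ is its interior. $\overset d=$ denotes equality of finite-dimensional distributions of processes in $t$; the self-similarity relation presupposes $\mu+f(c)\in\overline\Omega$. Exponential family of Lévy processes: each $X(\mu;\cdot)$ is a Lévy process (started at $0$), and the laws of $X(\mu;1)$, $\mu\in\overline\Omega$, form a full natural exponential family parametrized by its mean $\mu$. That is, they are the measures $e^{\theta x-\kappa(\theta)}P(dx)$, $\theta\in\Theta$, where $P$ is a probability measure with cumulant generating function $\kappa$, $\Theta=\{\theta:\kappa(\theta)<\infty\}$ has non-empty interior, $\mu=\dot\kappa(\theta)$ and $\overline\Omega=\dot\kappa(\Theta)$ (at endpoints of $\Theta$, $\dot\kappa$ is the one-sided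 limit, possibly $\pm\infty$). The variance function is $V(\mu)=\mathrm{Var}[X(\mu;1)]$, $\mu\in\Omega$, so $\mathrm{Var}[X(\mu;t)]=tV(\mu)$. Non-degenerate means the processes are not deterministic straight lines. The family $S_\infty(\mu,b;t)$: for $b\neq0$, $\mathrm{Tw}_\infty(\mu,b,t)$ denotes the infinitely divisible exponential dispersion model with mean $\mu$ and variance $t^{-1}\sigma^2e^{b\mu}$ ($\mu\in\mathbb{R}$), and $S_\infty(\mu,b;\cdot)$ is the Lévy process for which $S_\infty(\mu,b;t)$ is distributed as $t$ times a $\mathrm{Tw}_\infty(\mu,b,t)$ variable, $t>0$. Its index set is $\overline\Omega_b=(-\infty,\infty]$ for $b>0$ and $[-\infty,\infty)$ for $b<0$, the infinite endpoint corresponding to an extreme $1$-stable Lévy process from which the family is generated by exponential tilting. *)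

theory Defs
  imports "HOL-Probability.Probability"
begin

text \<open>
  Levy processes are taken ``in law'': stochastic continuity is required, cadlag paths are not.
  Everything below depends only on finite-dimensional distributions, so processes that are
  cadlag in addition are covered.
\<close>

definition levy_process :: "'w measure \<Rightarrow> (real \<Rightarrow> 'w \<Rightarrow> real) \<Rightarrow> bool" where
  "levy_process M X \<longleftrightarrow>
     prob_space M \<and>
     (\<forall>t\<ge>0. X t \<in> borel_measurable M) \<and>
     (AE \<omega> in M. X 0 \<omega> = 0) \<and>
     (\<forall>n (\<tau> :: nat \<Rightarrow> real). 0 \<le> \<tau> 0 \<and> (\<forall>i<n. \<tau> i \<le> \<tau> (Suc i)) \<longrightarrow>
        prob_space.indep_vars M (\<lambda>_. borel) (\<lambda>i \<omega>. X (\<tau> (Suc i)) \<omega> - X (\<tau> i) \<omega>) {..<n}) \<and>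
     (\<forall>s\<ge>0. \<forall>h\<ge>0. distr M borel (\<lambda>\<omega>. X (s + h) \<omega> - X s \<omega>) = distr M borel (X h)) \<and>
     (\<forall>s\<ge>0. \<forall>\<epsilon>>0.
        ((\<lambda>t. measure M {\<omega> \<in> space M. \<bar>X t \<omega> - X s \<omega>\<bar> > \<epsilon>}) \<longlongrightarrow> 0) (at s within {0..}))"

definition fdd_eq ::
    "'t set \<Rightarrow> 'v measure \<Rightarrow> ('t \<Rightarrow> 'v \<Rightarrow> 'b :: topological_space) \<Rightarrow>
     'w measure \<Rightarrow> ('t \<Rightarrow> 'w \<Rightarrow> 'b) \<Rightarrow> bool" where
  "fdd_eq I M Y N Z \<longleftrightarrow>
     (\<forall>T. finite T \<and> T \<subseteq> I \<longrightarrow>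
        distr M (PiM T (\<lambda>_. borel)) (\<lambda>\<omega>. \<lambda>t\<in>T. Y t \<omega>) =
        distr N (PiM T (\<lambda>_. borel)) (\<lambda>\<omega>. \<lambda>t\<in>T. Z t \<omega>))"

text \<open>
  \<open>cgf_dom P\<close> is the set \<open>\<Theta>\<close> on which the cumulant generating function is finite;
  \<open>cgf P\<close> is meaningful only there.
\<close>

definition cgf_dom :: "real measure \<Rightarrow> real set" where
  "cgf_dom P = {\<theta>. integrable P (\<lambda>x. exp (\<theta> * x))}"

definition cgf :: "real measure \<Rightarrow> real \<Rightarrow> real" where
  "cgf P \<theta> = ln (\<integral>x. exp (\<theta> * x) \<partial>P)"

text \<open>At an endpoint of \<open>\<Theta>\<close> the limit below is one-sided, as \<open>\<Theta>\<close> is an interval.\<close>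

definition mean_map :: "real measure \<Rightarrow> real \<Rightarrow> ereal" where
  "mean_map P \<theta> =
     (if \<theta> \<in> interior (cgf_dom P) then ereal (deriv (cgf P) \<theta>)
      else Lim (at \<theta> within interior (cgf_dom P)) (\<lambda>x. ereal (deriv (cgf P) x)))"

definition index_set :: "ereal set \<Rightarrow> bool" where
  "index_set \<Omega>' \<longleftrightarrow>
     (\<forall>x\<in>\<Omega>'. \<forall>y\<in>\<Omega>'. {x..y} \<subseteq> \<Omega>') \<and>
     ereal ` {0<..} \<subseteq> \<Omega>' \<and>
     (\<forall>c>0. (\<lambda>x. ereal c * x) ` \<Omega>' \<subseteq> \<Omega>')"

text \<open>
  The interior is taken in the real line: in the topology of \<^typ>\<open>ereal\<close> an infinite endpoint
  would be an interior point.
\<close>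

definition index_interior :: "ereal set \<Rightarrow> real set" where
  "index_interior \<Omega>' = interior {x. ereal x \<in> \<Omega>'}"

text \<open>
  Only the law of each single process \<open>X \<mu>\<close> matters, so each may live on its own probability
  space \<open>M \<mu>\<close>.
\<close>

definition exp_family_levy ::
    "ereal set \<Rightarrow> (ereal \<Rightarrow> 'w measure) \<Rightarrow> (ereal \<Rightarrow> real \<Rightarrow> 'w \<Rightarrow> real) \<Rightarrow> bool" where
  "exp_family_levy \<Omega>' M X \<longleftrightarrow>
     (\<forall>\<mu>\<in>\<Omega>'. levy_process (M \<mu>) (X \<mu>)) \<and>
     (\<exists>P. prob_space P \<and> sets P = sets borel \<and>
          interior (cgf_dom P) \<noteq> {} \<and>
          \<Omega>' = mean_map P ` cgf_dom P \<and>
          (\<forall>\<theta>\<in>cgf_dom P.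
             distr (M (mean_map P \<theta>)) borel (X (mean_map P \<theta>) 1) =
             density P (\<lambda>x. ennreal (exp (\<theta> * x - cgf P \<theta>)))))"

definition nondegenerate ::
    "ereal set \<Rightarrow> (ereal \<Rightarrow> 'w measure) \<Rightarrow> (ereal \<Rightarrow> real \<Rightarrow> 'w \<Rightarrow> real) \<Rightarrow> bool" where
  "nondegenerate \<Omega>' M X \<longleftrightarrow>
     (\<forall>\<mu>\<in>\<Omega>'. \<not> (\<exists>m. \<forall>t\<ge>0. AE \<omega> in M \<mu>. X \<mu> t \<omega> = m * t))"

definition variance_function ::
    "(ereal \<Rightarrow> 'w measure) \<Rightarrow> (ereal \<Rightarrow> real \<Rightarrow> 'w \<Rightarrow> real) \<Rightarrow> real \<Rightarrow> real" where
  "variance_function M X \<mu> = prob_space.variance (M (ereal \<mu>)) (X (ereal \<mu>) 1)"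

text \<open>
  Self-similarity with Hurst exponent 1 in the extended sense. As \<open>f\<close> takes values in a set of
  extended reals, the two sides are compared as \<^typ>\<open>ereal\<close>-valued processes.
\<close>

definition self_similar_ext_1 ::
    "ereal set \<Rightarrow> (ereal \<Rightarrow> 'w measure) \<Rightarrow> (ereal \<Rightarrow> real \<Rightarrow> 'w \<Rightarrow> real) \<Rightarrow> bool" where
  "self_similar_ext_1 \<Omega>' M X \<longleftrightarrow>
     (\<exists>f :: real \<Rightarrow> ereal. \<forall>c>0. f c \<in> \<Omega>' \<and>
        (\<forall>\<mu>\<in>\<Omega>'. \<mu> + f c \<in> \<Omega>' \<and>
           fdd_eq {0<..}
             (M (\<mu> + f c)) (\<lambda>t \<omega>. ereal (X (\<mu> + f c) (c * t) \<omega>))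
             (M \<mu>) (\<lambda>t \<omega>. ereal c * (ereal (X \<mu> t \<omega>) + ereal t * f c))))"

text \<open>
  \<open>inf_div_edm P D\<close>: the exponential dispersion model (in reproductive form) generated by \<open>P\<close>,
  with \<open>D \<mu> t\<close> the member \<open>exp (t (\<theta> y - \<kappa>(\<theta>))) \<nu>\<^sub>t(dy)\<close> of mean \<open>\<mu> = \<kappa>'(\<theta>)\<close>
  and index parameter \<open>t\<close>. Here \<open>\<nu>\<^sub>t\<close> has cumulant generating function \<open>s \<mapsto> t \<kappa>(s / t)\<close>; the
  model is infinitely divisible since every \<open>t > 0\<close> is admitted.
\<close>

definition inf_div_edm :: "real measure \<Rightarrow> (ereal \<Rightarrow> real \<Rightarrow> real measure) \<Rightarrow> bool" where
  "inf_div_edm P D \<longleftrightarrow>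
     prob_space P \<and> sets P = sets borel \<and> interior (cgf_dom P) \<noteq> {} \<and>
     (\<exists>\<nu> :: real \<Rightarrow> real measure. \<forall>t>0.
        prob_space (\<nu> t) \<and> sets (\<nu> t) = sets borel \<and>
        cgf_dom (\<nu> t) = (\<lambda>\<theta>. t * \<theta>) ` cgf_dom P \<and>
        (\<forall>\<theta>\<in>cgf_dom P.
           cgf (\<nu> t) (t * \<theta>) = t * cgf P \<theta> \<and>
           D (mean_map P \<theta>) t = density (\<nu> t) (\<lambda>y. ennreal (exp (t * (\<theta> * y - cgf P \<theta>))))))"

definition hougaard_index_set :: "real \<Rightarrow> ereal set" where
  "hougaard_index_set b = (if b > 0 then {-\<infinity><..} else {..<\<infinity>})"

text \<open>\<open>D \<mu> t\<close> plays the role of \<open>Tw\<^sub>\<infinity>(\<mu>, b, t)\<close>, with \<open>v\<close> for \<open>\<sigma>\<^sup>2\<close>.\<close>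

definition tweedie_infinity ::
    "real \<Rightarrow> real \<Rightarrow> (ereal \<Rightarrow> real \<Rightarrow> real measure) \<Rightarrow> bool" where
  "tweedie_infinity v b D \<longleftrightarrow>
     (\<exists>P. inf_div_edm P D \<and> mean_map P ` cgf_dom P = hougaard_index_set b) \<and>
     (\<forall>\<mu> :: real. \<forall>t>0.
        prob_space.expectation (D (ereal \<mu>) t) (\<lambda>y. y) = \<mu> \<and>
        prob_space.variance (D (ereal \<mu>) t) (\<lambda>y. y) = v * exp (b * \<mu>) / t)"

definition hougaard_infinity_family ::
    "real \<Rightarrow> real \<Rightarrow> ereal set \<Rightarrow> (ereal \<Rightarrow> 'w measure) \<Rightarrow>
     (ereal \<Rightarrow> real \<Rightarrow> 'w \<Rightarrow> real) \<Rightarrow> bool" where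
  "hougaard_infinity_family v b \<Omega>' M X \<longleftrightarrow>
     \<Omega>' = hougaard_index_set b \<and>
     (\<exists>D. tweedie_infinity v b D \<and>
        (\<forall>\<mu>\<in>\<Omega>'. levy_process (M \<mu>) (X \<mu>) \<and>
           (\<forall>t>0. distr (M \<mu>) borel (X \<mu> t) = distr (D \<mu> t) borel (\<lambda>y. t * y))))"

end

theory Submission
  imports Defs "HOL-Complex_Analysis.Complex_Analysis" "HOL-Real_Asymp.Real_Asymp"
begin

text \<open>
  Write \<open>\<kappa>\<close> for the cumulant generating function and \<open>\<Theta>\<close> for its domain. A Levy process whose time-one
  law is the tilt of \<open>P\<close> at \<open>\<theta>\<close> has \<open>s \<mapsto> t (\<kappa>(\<theta> + s) - \<kappa>(\<theta>))\<close> as cumulant generating function at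
  time \<open>t\<close>, and laws with the same cumulant generating function on an open interval agree. Hence
  self-similarity says that for each \<open>\<theta>\<close> and \<open>c\<close> there is \<open>\<theta>'\<close> with \<open>\<Theta> - \<theta>' = (\<Theta> - \<theta>) / c\<close> and
  \<open>\<kappa>(\<theta>' + s) - \<kappa>(\<theta>') = (\<kappa>(\<theta> + c s) - \<kappa>(\<theta>)) / c + r s\<close>; differentiating twice,
  \<open>\<kappa>''(\<theta>' + s) = c \<kappa>''(\<theta> + c s)\<close>. This forces the interior of \<open>\<Theta>\<close> to be a half-line with
  endpoint \<open>\<theta>\<^sub>0\<close> on which \<open>\<kappa>''\<close> is a multiple of \<open>1 / \<bar>\<theta>\<^sub>0 - \<theta>\<bar>\<close>, so \<open>\<kappa>'\<close> is logarithmic and the variance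
  is exponential in the mean. Conversely, \<open>\<kappa>'' = v exp (b \<kappa>')\<close> makes \<open>u = exp (- b \<kappa>')\<close> an affine function
  of \<open>\<theta>\<close> and \<open>\<kappa> = (u ln u - u) / (b\<^sup>2 v) + C\<close>, from which self-similarity with \<open>f(c) = ln c / b\<close>
  is read off.
\<close>

section \<open>Moment generating functions on a strip\<close>

text \<open>The obstacle is the member at an endpoint of \<Theta>: its cumulant generating function
  is finite on one side of 0 only and its mean may be infinite, so neither moments nor a transform
  near 0 identify it. Laws are therefore compared on an arbitrary open interval, and every
  derivative is taken in the interior of \<Theta>. The two directions use the self-similarity
  relation differently. For necessity, time \<open>t = 1\<close> and interior \<theta> are enough:
  \<open>f(c)\<close> adds a linear term to the cumulant generating function, so passing to
  \<open>\<kappa>''\<close> removes the unknown shift and leaves a pure dilation equation. For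
  sufficiency all finite-dimensional laws must agree, including those of the member with infinite
  mean; independent increments reduce this to marginals, and an explicit formula for \<kappa> valid
  up to the closed endpoint settles the marginals.\<close>

lemma has_field_derivative_of_quadratic_bound:
  fixes F :: "'a :: real_normed_field \<Rightarrow> 'a"
  assumes "r > 0"
    and bound: "\<And>h. norm h < r \<Longrightarrow> norm (F (z + h) - F z - h * D) \<le> C * norm h ^ 2"
  shows "(F has_field_derivative D) (at z)"
  unfolding DERIV_def
proof (rule LIM_zero_cancel, rule Lim_null_comparison)
  have "eventually (\<lambda>h. norm h < r \<and> h \<noteq> 0) (at (0::'a))"
    unfolding eventually_at using \<open>r > 0\<close> by (intro exI[of _ r]) (auto simp: dist_norm)
  then show "eventually (\<lambda>h. norm ((F (z + h) - F z) / h - D) \<le> C * norm h) (at 0)"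
  proof (rule eventually_mono)
    fix h :: 'a assume h: "norm h < r \<and> h \<noteq> 0"
    have "norm ((F (z + h) - F z) / h - D) = norm (F (z + h) - F z - h * D) / norm h"
      using h by (simp flip: norm_divide add: field_simps)
    also have "\<dots> \<le> C * norm h ^ 2 / norm h"
      using h bound by (intro divide_right_mono) auto
    finally show "norm ((F (z + h) - F z) / h - D) \<le> C * norm h"
      using h by (simp add: power2_eq_square)
  qed
  show "((\<lambda>h. C * norm h) \<longlongrightarrow> 0) (at (0::'a))"
    by (auto intro!: tendsto_eq_intros)
qed

text \<open>A single majorant for all rates between \<open>a\<close> and \<open>b\<close>; it yields
  convexity of the domain and dominated convergence up to the endpoints.\<close>

lemma exp_mult_le_endpoints:
  fixes a b t x :: real
  assumes "a \<le> t" "t \<le> b"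
  shows "exp (t * x) \<le> exp (a * x) + exp (b * x)"
proof (cases "x \<ge> 0")
  case True
  then have "exp (t * x) \<le> exp (b * x)"
    using assms by (simp add: mult_right_mono)
  then show ?thesis by (simp add: add_increasing)
next
  case False
  then have "exp (t * x) \<le> exp (a * x)"
    using assms by (simp add: mult_right_mono_neg)
  then show ?thesis by (simp add: add_increasing2)
qed

text \<open>The factor \<open>exp (r * \<bar>x\<bar>)\<close> leaves room for complex perturbations
  \<open>h\<close> with \<open>norm h < r\<close>. The power is absorbed by one term of the
  exponential series at the cost of a second such factor; hence the shift by
  \<open>2 * r\<close>.\<close>

lemma power_exp_le:
  fixes r s x :: real
  assumes "r > 0"
  shows "\<bar>x\<bar> ^ n * exp (s * x) * exp (r * \<bar>x\<bar>) \<le>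
         fact n / r ^ n * (exp ((s + 2 * r) * x) + exp ((s - 2 * r) * x))"
proof -
  have "(\<Sum>i\<in>{n}. (r * \<bar>x\<bar>) ^ i / fact i) \<le> (\<Sum>i. (r * \<bar>x\<bar>) ^ i / fact i)"
    using assms summable_exp_generic[of "r * \<bar>x\<bar>"]
    by (intro sum_le_suminf) (auto simp: divide_inverse mult.commute)
  then have "(r * \<bar>x\<bar>) ^ n / fact n \<le> exp (r * \<bar>x\<bar>)"
    by (simp add: exp_def divide_inverse mult.commute)
  then have "\<bar>x\<bar> ^ n \<le> fact n / r ^ n * exp (r * \<bar>x\<bar>)"
    using assms by (simp add: power_mult_distrib divide_simps mult.commute)
  then have "\<bar>x\<bar> ^ n * exp (s * x) * exp (r * \<bar>x\<bar>) \<le>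
      (fact n / r ^ n * exp (r * \<bar>x\<bar>)) * exp (s * x) * exp (r * \<bar>x\<bar>)"
    by (intro mult_right_mono) auto
  also have "\<dots> = fact n / r ^ n * exp (s * x + 2 * r * \<bar>x\<bar>)"
    by (simp add: exp_add exp_double power2_eq_square mult.assoc)
  also have "\<dots> \<le> fact n / r ^ n * (exp ((s + 2 * r) * x) + exp ((s - 2 * r) * x))"
  proof (rule mult_left_mono)
    show "exp (s * x + 2 * r * \<bar>x\<bar>) \<le> exp ((s + 2 * r) * x) + exp ((s - 2 * r) * x)"
    proof (cases "x \<ge> 0")
      case True
      then have "s * x + 2 * r * \<bar>x\<bar> = (s + 2 * r) * x" by (simp add: distrib_right)
      then show ?thesis by simp
    next
      case False
      then have "s * x + 2 * r * \<bar>x\<bar> = (s - 2 * r) * x" by (simp add: left_diff_distrib)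
      then show ?thesis by simp
    qed
  qed (use assms in auto)
  finally show ?thesis .
qed

lemma cgf_dom_nn:
  assumes [measurable_cong]: "sets P = sets borel"
  shows "\<theta> \<in> cgf_dom P \<longleftrightarrow> (\<integral>\<^sup>+x. ennreal (exp (\<theta> * x)) \<partial>P) < \<infinity>"
  unfolding cgf_dom_def by (subst mem_Collect_eq, subst integrable_iff_bounded) auto

lemma convex_cgf_dom:
  assumes [measurable_cong]: "sets P = sets borel"
  shows "convex (cgf_dom P)"
proof -
  have "t \<in> cgf_dom P" if "a \<in> cgf_dom P" "b \<in> cgf_dom P" "a \<le> t" "t \<le> b" for a b t
    unfolding cgf_dom_def mem_Collect_eq
  proof (rule Bochner_Integration.integrable_bound)
    show "integrable P (\<lambda>x. exp (a * x) + exp (b * x))"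
      using that by (auto simp: cgf_dom_def)
  qed (use exp_mult_le_endpoints[OF that(3,4)] in \<open>auto intro!: always_eventually\<close>)
  then show ?thesis
    unfolding is_interval_convex_1[symmetric] is_interval_1 by blast
qed

lemma integrable_power_exp:
  assumes [measurable_cong]: "sets P = sets borel" and "r > 0"
    and "s + 2 * r \<in> cgf_dom P" "s - 2 * r \<in> cgf_dom P"
  shows "integrable P (\<lambda>x. \<bar>x\<bar> ^ n * exp (s * x) * exp (r * \<bar>x\<bar>))"
proof (rule Bochner_Integration.integrable_bound)
  show "integrable P (\<lambda>x. fact n / r ^ n * (exp ((s + 2 * r) * x) + exp ((s - 2 * r) * x)))"
    using assms by (auto simp: cgf_dom_def)
  show "AE x in P. norm (\<bar>x\<bar> ^ n * exp (s * x) * exp (r * \<bar>x\<bar>)) \<le>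
      norm (fact n / r ^ n * (exp ((s + 2 * r) * x) + exp ((s - 2 * r) * x)))"
    using power_exp_le[OF \<open>r > 0\<close>] \<open>r > 0\<close>
    by (intro always_eventually allI) (simp add: abs_mult)
qed measurable

lemma interior_cgf_dom_radius:
  assumes "s \<in> interior (cgf_dom P)"
  obtains r where "r > 0" "s + 2 * r \<in> cgf_dom P" "s - 2 * r \<in> cgf_dom P"
proof -
  obtain e where e: "e > 0" "cball s e \<subseteq> cgf_dom P"
    using assms mem_interior_cball by blast
  show ?thesis
    by (rule that[of "e / 2"]) (use e in \<open>auto simp: cball_def dist_real_def subset_iff\<close>)
qed

section \<open>Complex moments and differentiation under the integral sign\<close>

definition complex_moment :: "real measure \<Rightarrow> nat \<Rightarrow> complex \<Rightarrow> complex" where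
  "complex_moment P n z = (\<integral>x. of_real x ^ n * exp (z * of_real x) \<partial>P)"

lemma integrable_complex_moment:
  assumes [measurable_cong]: "sets P = sets borel" and "Re z \<in> interior (cgf_dom P)"
  shows "integrable P (\<lambda>x. of_real x ^ n * exp (z * of_real x) :: complex)"
proof -
  obtain r where r: "r > 0" "Re z + 2 * r \<in> cgf_dom P" "Re z - 2 * r \<in> cgf_dom P"
    using interior_cgf_dom_radius[OF assms(2)] .
  show ?thesis
  proof (rule Bochner_Integration.integrable_bound[OF integrable_power_exp[OF assms(1) r, of n]])
    have "\<bar>x\<bar> ^ n * exp (Re z * x) \<le> \<bar>x\<bar> ^ n * exp (Re z * x) * exp (r * \<bar>x\<bar>)" for x
      using r mult_left_mono[of 1 "exp (r * \<bar>x\<bar>)" "\<bar>x\<bar> ^ n * exp (Re z * x)"] by simp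
    then show "AE x in P. norm (of_real x ^ n * exp (z * of_real x) :: complex) \<le>
        norm (\<bar>x\<bar> ^ n * exp (Re z * x) * exp (r * \<bar>x\<bar>))"
      by (simp add: norm_mult norm_power)
  qed measurable
qed

text \<open>The remainder of \<open>exp (h * x)\<close> after its linear term is at most
  \<open>(norm h * \<bar>x\<bar>)\<^sup>2 * exp (norm h * \<bar>x\<bar>)\<close>; the extra
  exponential stays integrable for \<open>norm h < r\<close>, which gives a quadratic bound after
  integration.\<close>

lemma has_field_derivative_complex_moment:
  assumes [measurable_cong]: "sets P = sets borel" and "Re z \<in> interior (cgf_dom P)"
  shows "(complex_moment P n has_field_derivative complex_moment P (Suc n) z) (at z)"
proof -
  obtain r where r: "r > 0" "Re z + 2 * r \<in> cgf_dom P" "Re z - 2 * r \<in> cgf_dom P"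
    using interior_cgf_dom_radius[OF assms(2)] .
  obtain d where d: "d > 0" "ball (Re z) d \<subseteq> interior (cgf_dom P)"
    using assms(2) open_contains_ball[of "interior (cgf_dom P)"] by auto
  let ?g = "\<lambda>x. \<bar>x\<bar> ^ (n + 2) * exp (Re z * x) * exp (r * \<bar>x\<bar>)"
  note g = integrable_power_exp[OF assms(1) r, of "n + 2"]
  show ?thesis
  proof (rule has_field_derivative_of_quadratic_bound)
    \<comment> \<open>The radius \<open>r\<close> makes the remainder integrable; \<open>d\<close>
      keeps \<open>Re (z + h)\<close> in the interior, so that the moment at \<open>z + h\<close>
      exists.\<close>
    show "min r d > 0" using r d by simp
    fix h :: complex assume h: "norm h < min r d"
    have h': "Re (z + h) \<in> interior (cgf_dom P)"
    proof -
      have "\<bar>Re h\<bar> < d" using h abs_Re_le_cmod[of h] by linarith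
      then show ?thesis using d by (auto simp: ball_def dist_real_def subset_iff)
    qed
    note i = integrable_complex_moment[OF assms(1)]
    let ?f = "\<lambda>x. of_real x ^ n * exp ((z + h) * of_real x) - of_real x ^ n * exp (z * of_real x)
          - h * (of_real x ^ Suc n * exp (z * of_real x)) :: complex"
    have "complex_moment P n (z + h) - complex_moment P n z - h * complex_moment P (Suc n) z
        = (\<integral>x. ?f x \<partial>P)"
      unfolding complex_moment_def using i[OF h', of n] i[OF assms(2), of n] i[OF assms(2), of "Suc n"]
      by (simp del: power_Suc)
    also have "norm \<dots> \<le> (\<integral>x. norm h ^ 2 * ?g x \<partial>P)"
    proof (rule Bochner_Integration.integral_norm_bound_integral)
      show "integrable P ?f" using i[OF h', of n] i[OF assms(2), of n] i[OF assms(2), of "Suc n"]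
        by (simp del: power_Suc)
      show "integrable P (\<lambda>x. norm h ^ 2 * ?g x)" using g by simp
      fix x :: real
      have "?f x = of_real x ^ n * exp (z * of_real x) *
          (exp (h * of_real x) - (\<Sum>i\<le>1. (h * of_real x) ^ i / fact i))"
        by (simp add: ring_distribs exp_add)
      also have "norm \<dots> \<le> \<bar>x\<bar> ^ n * exp (Re z * x) * (exp (norm h * \<bar>x\<bar>) * (norm h * \<bar>x\<bar>) ^ 2)"
        using Taylor_exp_field[of "h * of_real x" 1]
        by (auto simp: norm_mult norm_power numeral_2_eq_2 intro!: mult_left_mono)
      also have "\<dots> \<le> \<bar>x\<bar> ^ n * exp (Re z * x) * (exp (r * \<bar>x\<bar>) * (norm h * \<bar>x\<bar>) ^ 2)"
        using h by (intro mult_left_mono mult_right_mono) (auto simp: mult_right_mono)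
      finally show "norm (?f x) \<le> norm h ^ 2 * ?g x"
        by (simp only: power_add power_mult_distrib mult_ac)
    qed
    finally show "norm (complex_moment P n (z + h) - complex_moment P n z - h * complex_moment P (Suc n) z)
        \<le> (\<integral>x. ?g x \<partial>P) * norm h ^ 2"
      by (simp add: mult.commute)
  qed
qed

definition tilted_moment :: "real measure \<Rightarrow> nat \<Rightarrow> real \<Rightarrow> real" where
  "tilted_moment P n \<theta> = (\<integral>x. x ^ n * exp (\<theta> * x) \<partial>P)"

lemma complex_moment_of_real: "complex_moment P n (of_real \<theta>) = of_real (tilted_moment P n \<theta>)"
  unfolding complex_moment_def tilted_moment_def
  by (subst integral_complex_of_real[symmetric]) (simp flip: exp_of_real)

lemma integrable_tilted_moment:
  assumes "sets P = sets borel" "\<theta> \<in> interior (cgf_dom P)"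
  shows "integrable P (\<lambda>x. x ^ n * exp (\<theta> * x))"
proof -
  have "integrable P (\<lambda>x. Re (of_real x ^ n * exp (of_real \<theta> * of_real x)))"
    using integrable_complex_moment[of P "of_real \<theta>" n] assms by (intro integrable_Re) auto
  moreover have "of_real x ^ n * exp (of_real \<theta> * of_real x) =
      (of_real (x ^ n * exp (\<theta> * x)) :: complex)" for x
    by (simp flip: exp_of_real)
  ultimately show ?thesis by (simp del: of_real_mult of_real_power)
qed

lemma has_real_derivative_tilted_moment:
  assumes "sets P = sets borel" "\<theta> \<in> interior (cgf_dom P)"
  shows "(tilted_moment P n has_real_derivative tilted_moment P (Suc n) \<theta>) (at \<theta>)"
proof -
  have "((\<lambda>t. Re (complex_moment P n (of_real t))) has_real_derivative
      Re (complex_moment P (Suc n) (of_real \<theta>))) (at \<theta>)"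
    using has_field_derivative_complex_moment[of P "of_real \<theta>" n] assms
    by (intro has_field_derivative_Re) (auto intro!: has_vector_derivative_real_field)
  then show ?thesis by (simp add: complex_moment_of_real)
qed

text \<open>The interval may lie away from 0, so the imaginary axis may be out of reach. Both
  transforms are holomorphic in the vertical strip over the interval and agree there by the identity
  theorem. On the line through \<open>s\<close> they are, up to a constant, the characteristic
  functions of the laws tilted at \<open>s\<close>; these laws agree, and tilting can be
  undone.\<close>

lemma real_distribution_eqI_mgf:
  assumes A: "prob_space A" "sets A = sets borel" and B: "prob_space B" "sets B = sets borel"
    and "a < b" and "{a<..<b} \<subseteq> cgf_dom A" "{a<..<b} \<subseteq> cgf_dom B"
    and eq: "\<And>s. a < s \<Longrightarrow> s < b \<Longrightarrow> (\<integral>x. exp (s * x) \<partial>A) = (\<integral>x. exp (s * x) \<partial>B)"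
  shows "A = B"
proof -
  define S where "S = {z. a < Re z \<and> Re z < b}"
  define s where "s = (a + b) / 2"
  have s: "a < s" "s < b" using \<open>a < b\<close> by (auto simp: s_def)
  have int: "{a<..<b} \<subseteq> interior (cgf_dom A)" "{a<..<b} \<subseteq> interior (cgf_dom B)"
    using interior_maximal[OF assms(6)] interior_maximal[OF assms(7)] by auto
  have "S = {z. Re z > a} \<inter> {z. Re z < b}"
    by (auto simp: S_def)
  then have S: "open S" "convex S"
    by (simp_all add: open_Int open_halfspace_Re_gt open_halfspace_Re_lt
        convex_Int convex_halfspace_Re_gt convex_halfspace_Re_lt)
  have hol: "(\<lambda>z. complex_moment A 0 z - complex_moment B 0 z) holomorphic_on S"
    unfolding holomorphic_on_def
  proof
    fix z assume "z \<in> S"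
    then have z: "Re z \<in> {a<..<b}"
      by (simp add: S_def)
    have "Re z \<in> interior (cgf_dom A)" "Re z \<in> interior (cgf_dom B)"
      by (rule subsetD[OF int(1) z]) (rule subsetD[OF int(2) z])
    then have "complex_moment A 0 field_differentiable (at z)" "complex_moment B 0 field_differentiable (at z)"
      unfolding field_differentiable_def
      using has_field_derivative_complex_moment[OF A(2)] has_field_derivative_complex_moment[OF B(2)]
      by blast+
    then show "(\<lambda>z. complex_moment A 0 z - complex_moment B 0 z) field_differentiable (at z within S)"
      by (rule field_differentiable_at_within[OF field_differentiable_diff])
  qed
  have lim: "(of_real s :: complex) islimpt of_real ` {a<..<b}"
  proof -
    have "s islimpt {a<..<b}"
      using s by (intro interior_limit_point) (auto simp: interior_open)
    then show ?thesis
      by (rule islimpt_isCont_image) (auto simp: eventually_at_filter)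
  qed
  have zero: "complex_moment A 0 z - complex_moment B 0 z = 0" if "z \<in> S" for z
  proof (rule analytic_continuation[OF hol S(1) _ _ _ lim _ that])
    show "connected S" using S by (simp add: convex_connected)
    show "complex_moment A 0 w - complex_moment B 0 w = 0" if "w \<in> of_real ` {a<..<b}" for w
      using that eq by (auto simp: complex_moment_of_real tilted_moment_def)
  qed (use s in \<open>auto simp: S_def\<close>)
  have pos: "(\<integral>x. exp (s * x) \<partial>A) > 0"
  proof -
    interpret A: prob_space A by fact
    have "integrable A (\<lambda>x. exp (s * x))" using s assms by (auto simp: cgf_dom_def)
    then show ?thesis
      by (rule A.expectation_greater) simp
  qed
  define k where "k = (\<integral>x. exp (s * x) \<partial>A)"
  \<comment> \<open>The constant \<open>k\<close> is the same for \<open>A\<close> and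
    \<open>B\<close>, because their transforms agree at \<open>s\<close>; so one \<open>T\<close>
    normalises both.\<close>
  define T where "T C = density C (\<lambda>x. ennreal (exp (s * x) / k))" for C :: "real measure"
  have k: "k > 0" "k = (\<integral>x. exp (s * x) \<partial>B)" using pos eq s by (auto simp: k_def)
  have T: "real_distribution (T C)" "\<And>t. char (T C) t = complex_moment C 0 (of_real s + \<i> * of_real t) / of_real k"
    if C: "sets C = sets borel" "{a<..<b} \<subseteq> cgf_dom C" "k = (\<integral>x. exp (s * x) \<partial>C)" for C
  proof -
    note [measurable_cong] = C(1)
    have "integrable C (\<lambda>x. exp (s * x))" using s C by (auto simp: cgf_dom_def)
    then have "(\<integral>\<^sup>+x. ennreal (exp (s * x) / k) \<partial>C) = ennreal (\<integral>x. exp (s * x) / k \<partial>C)"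
      using k by (intro nn_integral_eq_integral) auto
    also have "\<dots> = 1" using C k by simp
    finally have "emeasure (T C) (space (T C)) = 1"
      unfolding T_def by (simp add: emeasure_density cong: nn_integral_cong)
    then have "prob_space (T C)" by (rule prob_spaceI)
    then show "real_distribution (T C)"
      by (simp add: real_distribution_def real_distribution_axioms_def T_def C sets_eq_imp_space_eq[OF C(1)])
    fix t
    have eq: "(exp (s * x) / k) *\<^sub>R iexp (t * x) =
        of_real x ^ 0 * exp ((of_real s + \<i> * of_real t) * of_real x) / of_real k" for x
      by (simp add: scaleR_conv_of_real ring_distribs exp_add mult.assoc flip: exp_of_real)
    have "char (T C) t = (\<integral>x. (exp (s * x) / k) *\<^sub>R iexp (t * x) \<partial>C)"
      unfolding char_def T_def using k(1) by (intro integral_density) auto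
    then show "char (T C) t = complex_moment C 0 (of_real s + \<i> * of_real t) / of_real k"
      unfolding eq complex_moment_def by simp
  qed
  have "T A = T B"
  proof (rule Levy_uniqueness)
    show "real_distribution (T A)" "real_distribution (T B)"
      using T(1)[OF A(2) assms(6) k_def] T(1)[OF B(2) assms(7) k(2)] by auto
    have "complex_moment A 0 (of_real s + \<i> * of_real t) = complex_moment B 0 (of_real s + \<i> * of_real t)" for t
      using zero[of "of_real s + \<i> * of_real t"] s by (simp add: S_def)
    then show "char (T A) = char (T B)"
      unfolding fun_eq_iff T(2)[OF A(2) assms(6) k_def] T(2)[OF B(2) assms(7) k(2)] by simp
  qed
  \<comment> \<open>The density of the tilt is strictly positive, so multiplying by its reciprocal
    recovers the original law.\<close>
  moreover have "density (T C) (\<lambda>x. ennreal (k / exp (s * x))) = C" if C: "sets C = sets borel" for C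
  proof -
    note [measurable_cong] = C(1)
    have "density (T C) (\<lambda>x. ennreal (k / exp (s * x))) = density C (\<lambda>x. 1)"
      unfolding T_def using k by (subst density_density_eq)
        (auto simp: ennreal_mult[symmetric] intro!: density_cong)
    then show ?thesis by (simp add: density_1)
  qed
  ultimately show ?thesis using A B by metis
qed

section \<open>Levy processes in law\<close>

lemma levy_processD:
  assumes "levy_process M X"
  shows levy_process_prob_space: "prob_space M"
    and levy_process_measurable: "t \<ge> 0 \<Longrightarrow> X t \<in> borel_measurable M"
    and levy_process_zero: "AE \<omega> in M. X 0 \<omega> = 0"
    and levy_process_indep: "0 \<le> \<tau> 0 \<Longrightarrow> (\<And>i. i < n \<Longrightarrow> \<tau> i \<le> \<tau> (Suc i)) \<Longrightarrow>
      prob_space.indep_vars M (\<lambda>_. borel) (\<lambda>i \<omega>. X (\<tau> (Suc i)) \<omega> - X (\<tau> i) \<omega>) {..<n}"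
    and levy_process_stationary: "s \<ge> 0 \<Longrightarrow> h \<ge> 0 \<Longrightarrow>
      distr M borel (\<lambda>\<omega>. X (s + h) \<omega> - X s \<omega>) = distr M borel (X h)"
    and levy_process_continuous: "s \<ge> 0 \<Longrightarrow> \<epsilon> > 0 \<Longrightarrow>
      ((\<lambda>t. measure M {\<omega> \<in> space M. \<bar>X t \<omega> - X s \<omega>\<bar> > \<epsilon>}) \<longlongrightarrow> 0) (at s within {0..})"
  using assms unfolding levy_process_def by auto

section \<open>The moment generating function of a Levy process as a function of time\<close>

definition levy_mgf :: "'w measure \<Rightarrow> (real \<Rightarrow> 'w \<Rightarrow> real) \<Rightarrow> real \<Rightarrow> real \<Rightarrow> ennreal" where
  "levy_mgf M X \<theta> t = (\<integral>\<^sup>+\<omega>. ennreal (exp (\<theta> * X t \<omega>)) \<partial>M)"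

text \<open>Because \<open>levy_mgf\<close> takes extended values, multiplicativity is available
  before anything is known about finiteness; finiteness at other times is deduced from it.\<close>

lemma levy_mgf_add:
  assumes X: "levy_process M X" and st: "s \<ge> 0" "t \<ge> 0"
  shows "levy_mgf M X \<theta> (s + t) = levy_mgf M X \<theta> s * levy_mgf M X \<theta> t"
proof -
  interpret prob_space M using levy_process_prob_space[OF X] .
  note [measurable] = levy_process_measurable[OF X]
  \<comment> \<open>A grid with the two increments \<open>[0, s]\<close> and
    \<open>[s, s + t]\<close>. The first one equals \<open>X s\<close> only almost surely, as
    \<open>X 0 = 0\<close> holds only almost surely.\<close>
  define \<tau> :: "nat \<Rightarrow> real" where "\<tau> i = (if i = 0 then 0 else if i = 1 then s else s + t)" for i
  define D where "D i \<omega> = X (\<tau> (Suc i)) \<omega> - X (\<tau> i) \<omega>" for i \<omega>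
  have "indep_vars (\<lambda>_. borel) D {..<2}"
    unfolding D_def by (rule levy_process_indep[OF X]) (use st in \<open>auto simp: \<tau>_def\<close>)
  then have ind: "indep_vars (\<lambda>_. borel) (\<lambda>i \<omega>. ennreal (exp (\<theta> * D i \<omega>))) {..<2}"
    by (rule indep_vars_compose2) measurable
  have "levy_mgf M X \<theta> (s + t) = (\<integral>\<^sup>+\<omega>. (\<Prod>i<2. ennreal (exp (\<theta> * D i \<omega>))) \<partial>M)"
    unfolding levy_mgf_def
  proof (rule nn_integral_cong_AE)
    show "AE \<omega> in M. ennreal (exp (\<theta> * X (s + t) \<omega>)) = (\<Prod>i<2. ennreal (exp (\<theta> * D i \<omega>)))"
      using levy_process_zero[OF X]
      by eventually_elim
        (simp add: D_def \<tau>_def numeral_2_eq_2 ennreal_mult[symmetric] exp_add[symmetric] algebra_simps)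
  qed
  also have "\<dots> = (\<Prod>i<2. \<integral>\<^sup>+\<omega>. ennreal (exp (\<theta> * D i \<omega>)) \<partial>M)"
    by (rule indep_vars_nn_integral) (use ind in auto)
  also have "\<dots> = (\<integral>\<^sup>+\<omega>. ennreal (exp (\<theta> * D 0 \<omega>)) \<partial>M) * (\<integral>\<^sup>+\<omega>. ennreal (exp (\<theta> * D 1 \<omega>)) \<partial>M)"
    by (simp add: numeral_2_eq_2)
  also have "(\<integral>\<^sup>+\<omega>. ennreal (exp (\<theta> * D 0 \<omega>)) \<partial>M) = levy_mgf M X \<theta> s"
    unfolding levy_mgf_def
  proof (rule nn_integral_cong_AE)
    show "AE \<omega> in M. ennreal (exp (\<theta> * D 0 \<omega>)) = ennreal (exp (\<theta> * X s \<omega>))"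
      using levy_process_zero[OF X] by eventually_elim (simp add: D_def \<tau>_def)
  qed
  also have "(\<integral>\<^sup>+\<omega>. ennreal (exp (\<theta> * D 1 \<omega>)) \<partial>M) =
      (\<integral>\<^sup>+x. ennreal (exp (\<theta> * x)) \<partial>distr M borel (\<lambda>\<omega>. X (s + t) \<omega> - X s \<omega>))"
    using st by (subst nn_integral_distr) (auto simp: D_def \<tau>_def)
  also have "\<dots> = levy_mgf M X \<theta> t"
    unfolding levy_process_stationary[OF X st] levy_mgf_def
    using st by (subst nn_integral_distr) auto
  finally show ?thesis .
qed

lemma levy_mgf_pos:
  assumes X: "levy_process M X" and "t \<ge> 0"
  shows "levy_mgf M X \<theta> t > 0"
proof -
  interpret prob_space M using levy_process_prob_space[OF X] .
  note [measurable] = levy_process_measurable[OF X]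
  have "\<not> (AE \<omega> in M. ennreal (exp (\<theta> * X t \<omega>)) = 0)"
    by simp
  then have "levy_mgf M X \<theta> t \<noteq> 0"
    unfolding levy_mgf_def using assms(2) by (subst nn_integral_0_iff_AE) auto
  then show ?thesis by (simp add: zero_less_iff_neq_zero)
qed

text \<open>A factor of a finite product is finite when the other factor is nonzero.\<close>

lemma levy_mgf_finite_mono:
  assumes X: "levy_process M X" and "0 \<le> t" "t \<le> u" and fin: "levy_mgf M X \<theta> u < \<infinity>"
  shows "levy_mgf M X \<theta> t < \<infinity>"
proof -
  have "levy_mgf M X \<theta> u = levy_mgf M X \<theta> t * levy_mgf M X \<theta> (u - t)"
    using levy_mgf_add[OF X, of t "u - t" \<theta>] assms by simp
  moreover have "levy_mgf M X \<theta> (u - t) > 0"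
    using levy_mgf_pos[OF X] assms by simp
  ultimately show ?thesis
    using fin by (auto simp: ennreal_mult_less_top)
qed

text \<open>Finiteness passes to multiples of \<open>u\<close> and from there to all smaller times,
  so it does not depend on which positive time is tested.\<close>

lemma levy_mgf_finite:
  assumes X: "levy_process M X" and "u > 0" "0 \<le> t" and fin: "levy_mgf M X \<theta> u < \<infinity>"
  shows "levy_mgf M X \<theta> t < \<infinity>"
proof -
  have *: "levy_mgf M X \<theta> (real (Suc n) * u) < \<infinity>" for n
  proof (induction n)
    case (Suc n)
    have "levy_mgf M X \<theta> (real (Suc n) * u + u) = levy_mgf M X \<theta> (real (Suc n) * u) * levy_mgf M X \<theta> u"
      using \<open>u > 0\<close> by (intro levy_mgf_add[OF X]) auto
    moreover have "real (Suc n) * u + u = real (Suc (Suc n)) * u" by (simp add: algebra_simps)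
    ultimately show ?case using Suc fin by (simp add: ennreal_mult_less_top)
  qed (use fin in simp)
  obtain n where "t < real n * u" using reals_Archimedean3[OF \<open>u > 0\<close>] by blast
  also have "\<dots> \<le> real (Suc n) * u" using \<open>u > 0\<close> by simp
  finally have "t < real (Suc n) * u" .
  then show ?thesis by (rule levy_mgf_finite_mono[OF X \<open>0 \<le> t\<close> less_imp_le *])
qed

text \<open>Stochastic continuity gives no upper bound on the moment generating function as \<open>t \<rightarrow> 0\<close>, but a
  lower bound suffices to make its logarithm, which is additive in \<open>t\<close>, linear.\<close>

lemma levy_mgf_lower_bound:
  assumes X: "levy_process M X"
  obtains \<delta> where "\<delta> > 0" "\<And>t. 0 \<le> t \<Longrightarrow> t \<le> \<delta> \<Longrightarrow> ennreal (exp (- \<bar>\<theta>\<bar>) / 2) \<le> levy_mgf M X \<theta> t"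
proof -
  interpret prob_space M using levy_process_prob_space[OF X] .
  note [measurable] = levy_process_measurable[OF X]
  \<comment> \<open>For small \<open>t\<close> the event \<open>\<bar>X t\<bar> \<le> 1\<close> has
    probability at least \<open>1 / 2\<close>, and on it \<open>exp (\<theta> * X t)\<close> is at
    least \<open>exp (- \<bar>\<theta>\<bar>)\<close>.\<close>
  have "eventually (\<lambda>t. measure M {\<omega> \<in> space M. \<bar>X t \<omega> - X 0 \<omega>\<bar> > 1} < 1 / 2) (at 0 within {0..})"
    using levy_process_continuous[OF X, of 0 1] by (intro order_tendstoD(2)[of _ 0]) auto
  then obtain d where d: "d > 0"
    "\<And>t. t \<ge> 0 \<Longrightarrow> t \<noteq> 0 \<Longrightarrow> dist t 0 < d \<Longrightarrow> measure M {\<omega> \<in> space M. \<bar>X t \<omega> - X 0 \<omega>\<bar> > 1} < 1 / 2"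
    unfolding eventually_at by auto
  show ?thesis
  proof (rule that[of "d / 2"])
    fix t assume t: "0 \<le> t" "t \<le> d / 2"
    define A where "A = {\<omega> \<in> space M. \<bar>X t \<omega> - X 0 \<omega>\<bar> > 1}"
    have [measurable]: "A \<in> sets M" unfolding A_def using t by measurable
    have "measure M A \<le> 1 / 2"
    \<comment> \<open>The limit filter omits the point 0 itself, where \<open>A\<close> is
      empty.\<close>
    proof (cases "t = 0")
      case False
      then show ?thesis using t d unfolding A_def by (intro less_imp_le d(2)) (auto simp: dist_real_def)
    qed (simp add: A_def)
    then have "1 / 2 \<le> prob (space M - A)"
      by (simp add: prob_compl)
    then have "ennreal (exp (- \<bar>\<theta>\<bar>) / 2) \<le> ennreal (exp (- \<bar>\<theta>\<bar>)) * emeasure M (space M - A)"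
      unfolding emeasure_eq_measure by (subst ennreal_mult[symmetric]) (auto intro!: ennreal_leI)
    also have "\<dots> = (\<integral>\<^sup>+\<omega>. ennreal (exp (- \<bar>\<theta>\<bar>)) * indicator (space M - A) \<omega> \<partial>M)"
      by (simp add: nn_integral_cmult_indicator)
    also have "\<dots> \<le> levy_mgf M X \<theta> t"
      unfolding levy_mgf_def
    proof (rule nn_integral_mono_AE)
      show "AE \<omega> in M. ennreal (exp (- \<bar>\<theta>\<bar>)) * indicator (space M - A) \<omega> \<le> ennreal (exp (\<theta> * X t \<omega>))"
        using levy_process_zero[OF X]
      proof eventually_elim
        fix \<omega> assume 0: "X 0 \<omega> = 0"
        show "ennreal (exp (- \<bar>\<theta>\<bar>)) * indicator (space M - A) \<omega> \<le> ennreal (exp (\<theta> * X t \<omega>))"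
        proof (cases "\<omega> \<in> space M - A")
          case True
          then have "\<bar>X t \<omega>\<bar> \<le> 1" by (auto simp: A_def 0)
          then have "\<bar>\<theta> * X t \<omega>\<bar> \<le> \<bar>\<theta>\<bar>" by (simp add: abs_mult mult_left_le)
          then show ?thesis using True by (auto intro!: ennreal_leI)
        next
          case False
          then have "indicator (space M - A) \<omega> = (0 :: ennreal)" by (rule indicator_simps(2))
          then show ?thesis by (simp only: mult_zero_right zero_le)
        qed
      qed
    qed
    finally show "ennreal (exp (- \<bar>\<theta>\<bar>) / 2) \<le> levy_mgf M X \<theta> t" .
  qed (use d in simp)
qed

text \<open>The defect \<open>h\<close> from linearity vanishes at the natural numbers, so its lower
  bound on \<open>[0, 1]\<close> holds on the whole half-line. Since
  \<open>h (n * t) = n * h t\<close>, a negative value would violate that bound; hence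
  \<open>h \<ge> 0\<close>. Finally \<open>h t + h (N - t) = h N = 0\<close> forces both summands to
  vanish.\<close>

lemma additive_nonneg_linear:
  fixes g :: "real \<Rightarrow> real"
  assumes add: "\<And>s t. 0 \<le> s \<Longrightarrow> 0 \<le> t \<Longrightarrow> g (s + t) = g s + g t"
    and "\<delta> > 0" and lower: "\<And>t. 0 \<le> t \<Longrightarrow> t \<le> \<delta> \<Longrightarrow> K \<le> g t"
    and "t \<ge> 0"
  shows "g t = t * g 1"
proof -
  have g_nat: "g (real n * t) = real n * g t" if "t \<ge> 0" for n t
  proof (induction n)
    case 0 then show ?case using add[of 0 0] by simp
  next
    case (Suc n)
    then show ?case using add[of "real n * t" t] that by (simp add: algebra_simps)
  qed
  define h where "h t = g t - t * g 1" for t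
  have h_add: "h (s + t) = h s + h t" if "0 \<le> s" "0 \<le> t" for s t
    using add[OF that] by (simp add: h_def algebra_simps)
  have h_nat: "h (real n * t) = real n * h t" if "t \<ge> 0" for n t
    using g_nat[OF that] by (simp add: h_def algebra_simps)
  have h0: "h (real n) = 0" for n using h_nat[of 1 n] by (simp add: h_def)
  obtain k :: nat where k: "1 < real k * \<delta>" using reals_Archimedean3[OF \<open>\<delta> > 0\<close>] by blast
  then have "k > 0" by (cases k) auto
  \<comment> \<open>A time in \<open>[0, 1]\<close> splits into \<open>k\<close> equal pieces of
    length at most \<open>\<delta>\<close>, each contributing at least \<open>K\<close>.\<close>
  define L where "L = real k * K - \<bar>g 1\<bar>"
  have L: "L \<le> h t" if "0 \<le> t" "t \<le> 1" for t
  proof -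
    have "t / real k \<le> \<delta>" using that k \<open>k > 0\<close> by (simp add: field_simps)
    then have "K \<le> g (t / real k)" using that by (intro lower) auto
    moreover have "g t = real k * g (t / real k)"
      using g_nat[of "t / real k" k] that \<open>k > 0\<close> by simp
    ultimately have "real k * K \<le> g t" by (simp add: mult_left_mono)
    moreover have "t * g 1 \<le> \<bar>g 1\<bar>"
      using that by (metis abs_ge_self abs_ge_zero abs_mult abs_of_nonneg mult_left_le_one_le order_trans)
    ultimately show ?thesis by (simp add: L_def h_def)
  qed
  have h_ge: "h t \<ge> 0" if "t \<ge> 0" for t
  proof (rule ccontr)
    assume "\<not> h t \<ge> 0"
    then have "- h t > 0" by simp
    from reals_Archimedean3[OF this] obtain n :: nat where n: "- L < real n * - h t" by blast
    define q where "q = nat \<lfloor>real n * t\<rfloor>"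
    have q: "real q \<le> real n * t" "real n * t - real q \<le> 1"
      using that by (auto simp: q_def) linarith
    have "real n * h t = h (real q + (real n * t - real q))"
      using h_nat[OF that, of n] by simp
    also have "\<dots> = h (real n * t - real q)"
      using q h0 by (subst h_add) auto
    also have "\<dots> \<ge> L" using q by (intro L) auto
    finally show False using n by simp
  qed
  obtain N :: nat where N: "t \<le> real N" using real_arch_simple by blast
  have "h t + h (real N - t) = 0"
    using h_add[of t "real N - t"] N \<open>t \<ge> 0\<close> h0[of N] by simp
  then have "h t = 0" using h_ge[of t] h_ge[of "real N - t"] N \<open>t \<ge> 0\<close> by simp
  then show ?thesis by (simp add: h_def)
qed

lemma levy_mgf_exponent:
  assumes X: "levy_process M X" and fin: "levy_mgf M X \<theta> 1 < \<infinity>" and "t \<ge> 0"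
  shows "levy_mgf M X \<theta> t = ennreal (exp (t * ln (enn2real (levy_mgf M X \<theta> 1))))"
proof -
  define g where "g t = ln (enn2real (levy_mgf M X \<theta> t))" for t
  have fin': "levy_mgf M X \<theta> t < \<infinity>" if "t \<ge> 0" for t
    using levy_mgf_finite[OF X _ that fin] by simp
  have pos: "enn2real (levy_mgf M X \<theta> t) > 0" if "t \<ge> 0" for t
    using levy_mgf_pos[OF X that] fin'[OF that] by (simp add: enn2real_positive_iff)
  have eq: "levy_mgf M X \<theta> t = ennreal (exp (g t))" if "t \<ge> 0" for t
    using pos[OF that] fin'[OF that] by (simp add: g_def)
  obtain \<delta> where \<delta>: "\<delta> > 0" "\<And>t. 0 \<le> t \<Longrightarrow> t \<le> \<delta> \<Longrightarrow> ennreal (exp (- \<bar>\<theta>\<bar>) / 2) \<le> levy_mgf M X \<theta> t"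
    using levy_mgf_lower_bound[OF X] by blast
  have "g t = t * g 1"
  proof (rule additive_nonneg_linear[where K = "ln (exp (- \<bar>\<theta>\<bar>) / 2)" and \<delta> = \<delta>])
    fix s t :: real assume st: "0 \<le> s" "0 \<le> t"
    show "g (s + t) = g s + g t"
      unfolding g_def levy_mgf_add[OF X st] enn2real_mult using pos[OF st(1)] pos[OF st(2)] by (simp add: ln_mult_pos)
  next
    fix t assume t: "0 \<le> t" "t \<le> \<delta>"
    have "exp (- \<bar>\<theta>\<bar>) / 2 \<le> exp (g t)"
      using \<delta>(2)[OF t] eq[OF t(1)] by (simp add: ennreal_le_iff)
    then show "ln (exp (- \<bar>\<theta>\<bar>) / 2) \<le> g t"
      by (subst ln_exp[symmetric, of "g t"]) (intro ln_mono; simp)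
  qed (rule \<delta>(1) \<open>t \<ge> 0\<close>)+
  then show ?thesis unfolding g_def[of 1, symmetric] eq[OF \<open>t \<ge> 0\<close>] by simp
qed

section \<open>Transformations and finite-dimensional laws of Levy processes\<close>

lemma levy_process_time_scale:
  assumes X: "levy_process M X" and "c > 0"
  shows "levy_process M (\<lambda>t. X (c * t))"
  unfolding levy_process_def
proof (intro conjI allI impI)
  show "prob_space M" using levy_process_prob_space[OF X] .
  fix t :: real assume "t \<ge> 0"
  then show "X (c * t) \<in> borel_measurable M"
    using \<open>c > 0\<close> by (intro levy_process_measurable[OF X]) simp
next
  show "AE \<omega> in M. X (c * 0) \<omega> = 0" using levy_process_zero[OF X] by simp
next
  fix n and \<tau> :: "nat \<Rightarrow> real" assume "0 \<le> \<tau> 0 \<and> (\<forall>i<n. \<tau> i \<le> \<tau> (Suc i))"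
  then show "prob_space.indep_vars M (\<lambda>_. borel) (\<lambda>i \<omega>. X (c * \<tau> (Suc i)) \<omega> - X (c * \<tau> i) \<omega>) {..<n}"
    using \<open>c > 0\<close> by (intro levy_process_indep[OF X, of "\<lambda>i. c * \<tau> i"]) auto
next
  fix s h :: real assume "s \<ge> 0" "h \<ge> 0"
  then show "distr M borel (\<lambda>\<omega>. X (c * (s + h)) \<omega> - X (c * s) \<omega>) = distr M borel (X (c * h))"
    using levy_process_stationary[OF X, of "c * s" "c * h"] \<open>c > 0\<close> by (simp add: distrib_left)
next
  fix s \<epsilon> :: real assume s: "s \<ge> 0" "\<epsilon> > 0"
  have "filterlim (\<lambda>t. c * t) (at (c * s) within {0..}) (at s within {0..})"
    unfolding filterlim_at
    using \<open>c > 0\<close> by (auto simp: eventually_at_filter intro!: tendsto_intros)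
  then show "((\<lambda>t. measure M {\<omega> \<in> space M. \<epsilon> < \<bar>X (c * t) \<omega> - X (c * s) \<omega>\<bar>}) \<longlongrightarrow> 0) (at s within {0..})"
    using s \<open>c > 0\<close>
    by (intro filterlim_compose[OF levy_process_continuous[OF X, of "c * s" \<epsilon>]]) auto
qed

lemma levy_process_affine:
  assumes X: "levy_process M X" and "a > 0"
  shows "levy_process M (\<lambda>t \<omega>. a * X t \<omega> + b * t)"
  unfolding levy_process_def
proof (intro conjI allI impI)
  note [measurable] = levy_process_measurable[OF X]
  interpret prob_space M using levy_process_prob_space[OF X] .
  show "prob_space M" by unfold_locales
  show "(\<lambda>\<omega>. a * X t \<omega> + b * t) \<in> borel_measurable M" if "t \<ge> 0" for t
    using that by measurable
  show "AE \<omega> in M. a * X 0 \<omega> + b * 0 = 0" using levy_process_zero[OF X] by simp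
  show "indep_vars (\<lambda>_. borel) (\<lambda>i \<omega>. a * X (\<tau> (Suc i)) \<omega> + b * \<tau> (Suc i) - (a * X (\<tau> i) \<omega> + b * \<tau> i)) {..<n}"
    if "0 \<le> \<tau> 0 \<and> (\<forall>i<n. \<tau> i \<le> \<tau> (Suc i))" for n \<tau>
  proof -
    have "indep_vars (\<lambda>_. borel) (\<lambda>i \<omega>. (\<lambda>i x. a * x + b * (\<tau> (Suc i) - \<tau> i)) i (X (\<tau> (Suc i)) \<omega> - X (\<tau> i) \<omega>)) {..<n}"
      by (rule indep_vars_compose2[OF levy_process_indep[OF X]]) (use that in auto)
    then show ?thesis by (simp add: algebra_simps)
  qed
  show "distr M borel (\<lambda>\<omega>. a * X (s + h) \<omega> + b * (s + h) - (a * X s \<omega> + b * s)) =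
      distr M borel (\<lambda>\<omega>. a * X h \<omega> + b * h)" if "s \<ge> 0" "h \<ge> 0" for s h
  proof -
    have "distr (distr M borel (\<lambda>\<omega>. X (s + h) \<omega> - X s \<omega>)) borel (\<lambda>x. a * x + b * h) =
        distr (distr M borel (X h)) borel (\<lambda>x. a * x + b * h)"
      using levy_process_stationary[OF X that] by simp
    then show ?thesis
      using that by (simp add: distr_distr comp_def algebra_simps)
  qed
  show "((\<lambda>t. prob {\<omega> \<in> space M. \<epsilon> < \<bar>a * X t \<omega> + b * t - (a * X s \<omega> + b * s)\<bar>}) \<longlongrightarrow> 0) (at s within {0..})"
    if s: "s \<ge> 0" "\<epsilon> > 0" for s \<epsilon>
  proof (rule tendsto_sandwich[OF _ _ tendsto_const])
    show "((\<lambda>t. prob {\<omega> \<in> space M. \<epsilon> / (2 * a) < \<bar>X t \<omega> - X s \<omega>\<bar>}) \<longlongrightarrow> 0) (at s within {0..})"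
      using s \<open>a > 0\<close> by (intro levy_process_continuous[OF X]) auto
    \<comment> \<open>Near \<open>s\<close> the drift moves by less than
      \<open>\<epsilon> / 2\<close>, so a total deviation above \<open>\<epsilon>\<close> forces
      \<open>X\<close> to move by more than \<open>\<epsilon> / (2 * a)\<close>.\<close>
    have "((\<lambda>t. \<bar>b * (t - s)\<bar>) \<longlongrightarrow> \<bar>b * (s - s)\<bar>) (at s within {0..})"
      by (intro tendsto_intros)
    then have "eventually (\<lambda>t. \<bar>b * (t - s)\<bar> < \<epsilon> / 2) (at s within {0..})"
      using s by (intro order_tendstoD(2)) auto
    moreover have "eventually (\<lambda>t. t \<in> {0..}) (at s within {0..})"
      by (auto simp: eventually_at_filter)
    ultimately show "eventually (\<lambda>t. prob {\<omega> \<in> space M. \<epsilon> < \<bar>a * X t \<omega> + b * t - (a * X s \<omega> + b * s)\<bar>} \<le>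
        prob {\<omega> \<in> space M. \<epsilon> / (2 * a) < \<bar>X t \<omega> - X s \<omega>\<bar>}) (at s within {0..})"
    proof eventually_elim
      fix t assume t: "\<bar>b * (t - s)\<bar> < \<epsilon> / 2" "t \<in> {0..}"
      have "\<epsilon> / (2 * a) < \<bar>X t \<omega> - X s \<omega>\<bar>" if "\<epsilon> < \<bar>a * X t \<omega> + b * t - (a * X s \<omega> + b * s)\<bar>" for \<omega>
      proof -
        have "a * X t \<omega> + b * t - (a * X s \<omega> + b * s) = a * (X t \<omega> - X s \<omega>) + b * (t - s)"
          by (simp add: algebra_simps)
        then have "\<epsilon> < \<bar>a * (X t \<omega> - X s \<omega>)\<bar> + \<bar>b * (t - s)\<bar>"
          using that abs_triangle_ineq[of "a * (X t \<omega> - X s \<omega>)" "b * (t - s)"] by simp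
        then have "\<epsilon> / 2 < a * \<bar>X t \<omega> - X s \<omega>\<bar>" using t \<open>a > 0\<close> by (simp add: abs_mult)
        then show ?thesis using \<open>a > 0\<close> by (simp add: field_simps)
      qed
      then show "prob {\<omega> \<in> space M. \<epsilon> < \<bar>a * X t \<omega> + b * t - (a * X s \<omega> + b * s)\<bar>} \<le>
          prob {\<omega> \<in> space M. \<epsilon> / (2 * a) < \<bar>X t \<omega> - X s \<omega>\<bar>}"
        using s t by (intro finite_measure_mono) auto
    qed
  qed (auto intro!: always_eventually)
qed

lemma levy_process_increments_distr:
  assumes X: "levy_process M X" and \<tau>: "0 \<le> \<tau> 0" "\<And>i. i < n \<Longrightarrow> \<tau> i \<le> \<tau> (Suc i)" and "n > 0"
  shows "distr M (PiM {..<n} (\<lambda>_. borel)) (\<lambda>\<omega>. \<lambda>i\<in>{..<n}. X (\<tau> (Suc i)) \<omega> - X (\<tau> i) \<omega>) =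
    PiM {..<n} (\<lambda>i. distr M borel (X (\<tau> (Suc i) - \<tau> i)))"
proof -
  interpret prob_space M using levy_process_prob_space[OF X] .
  note [measurable] = levy_process_measurable[OF X]
  have nn: "0 \<le> \<tau> i" if "i \<le> n" for i
    using that by (induction i) (use \<tau> in \<open>auto intro: order_trans\<close>)
  have "distr M (PiM {..<n} (\<lambda>_. borel)) (\<lambda>\<omega>. \<lambda>i\<in>{..<n}. X (\<tau> (Suc i)) \<omega> - X (\<tau> i) \<omega>) =
      PiM {..<n} (\<lambda>i. distr M borel (\<lambda>\<omega>. X (\<tau> (Suc i)) \<omega> - X (\<tau> i) \<omega>))"
    by (rule indep_vars_iff_distr_eq_PiM'[THEN iffD1, OF _ _ levy_process_indep[OF X \<tau>]])
      (use \<open>n > 0\<close> nn in auto)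
  also have "\<dots> = PiM {..<n} (\<lambda>i. distr M borel (X (\<tau> (Suc i) - \<tau> i)))"
  proof (rule PiM_cong)
    fix i assume "i \<in> {..<n}"
    then show "distr M borel (\<lambda>\<omega>. X (\<tau> (Suc i)) \<omega> - X (\<tau> i) \<omega>) = distr M borel (X (\<tau> (Suc i) - \<tau> i))"
      using levy_process_stationary[OF X, of "\<tau> i" "\<tau> (Suc i) - \<tau> i"] nn[of i] \<tau>(2)[of i] by simp
  qed simp
  finally show ?thesis .
qed

lemma levy_process_distr_0:
  assumes X: "levy_process M X"
  shows "distr M borel (X 0) = return borel 0"
proof -
  interpret prob_space M using levy_process_prob_space[OF X] .
  have "distr M borel (X 0) = distr M borel (\<lambda>_. 0)"
    using levy_process_zero[OF X] levy_process_measurable[OF X] by (intro distr_cong_AE) auto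
  then show ?thesis by (simp add: distr_const)
qed

text \<open>The values at finitely many times are partial sums of independent increments, and
  stationarity makes the law of each increment a one-dimensional marginal.\<close>

lemma levy_process_fdd_eqI:
  assumes X: "levy_process M X" and Y: "levy_process N Y"
    and marg: "\<And>t. t > 0 \<Longrightarrow> distr M borel (X t) = distr N borel (Y t)"
    and T: "finite T" "T \<subseteq> {0..}"
  shows "distr M (PiM T (\<lambda>_. borel)) (\<lambda>\<omega>. \<lambda>t\<in>T. X t \<omega>) =
         distr N (PiM T (\<lambda>_. borel)) (\<lambda>\<omega>. \<lambda>t\<in>T. Y t \<omega>)"
proof (cases "T = {}")
  case True
  have "distr K (PiM {} (\<lambda>_. borel)) (\<lambda>\<omega>. \<lambda>t\<in>{}. Z t \<omega>) = return (PiM {} (\<lambda>_. borel)) (\<lambda>_. undefined)"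
    if "levy_process K Z" for K :: "'k measure" and Z :: "real \<Rightarrow> 'k \<Rightarrow> real"
  proof -
    have "(\<lambda>_. undefined) \<in> space (PiM {} (\<lambda>_::real. borel :: real measure))"
      by (simp add: space_PiM)
    from prob_space.distr_const[OF levy_process_prob_space[OF that] this] show ?thesis
      by (simp add: restrict_def)
  qed
  with X Y True show ?thesis by metis
next
  case False
  define n where "n = card T"
  define xs where "xs = sorted_list_of_set T"
  have xs: "set xs = T" "sorted xs" "length xs = n"
    using T by (auto simp: xs_def n_def)
  have "n > 0" using False T by (auto simp: n_def card_gt_0_iff)
  \<comment> \<open>The sorted times with 0 put in front, hence the index shift: the value at
    \<open>xs ! j\<close> is the sum of the first \<open>Suc j\<close> increments.\<close>
  define \<tau> where "\<tau> i = (if i = 0 then 0 else xs ! (i - 1))" for i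
  have \<tau>0: "0 \<le> \<tau> 0" by (simp add: \<tau>_def)
  have \<tau>mono: "\<tau> i \<le> \<tau> (Suc i)" if "i < n" for i
  proof (cases i)
    case 0
    have "xs ! 0 \<in> T" using xs \<open>n > 0\<close> nth_mem[of 0 xs] by simp
    then show ?thesis using T 0 by (auto simp: \<tau>_def)
  next
    case (Suc j)
    then show ?thesis using xs that by (auto simp: \<tau>_def intro!: sorted_nth_mono)
  qed
  have nn: "0 \<le> \<tau> i" if "i \<le> n" for i
    using that by (induction i) (use \<tau>0 \<tau>mono in \<open>auto intro: order_trans\<close>)
  have "\<forall>t\<in>T. \<exists>k<n. xs ! k = t" using xs by (metis in_set_conv_nth)
  then obtain k where k: "\<And>t. t \<in> T \<Longrightarrow> k t < n" "\<And>t. t \<in> T \<Longrightarrow> xs ! k t = t"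
    by (metis (full_types))
  define g where "g d = (\<lambda>t\<in>T. \<Sum>i<Suc (k t). d i :: real)" for d
  have [measurable]: "g \<in> PiM {..<n} (\<lambda>_. borel) \<rightarrow>\<^sub>M PiM T (\<lambda>_. borel)"
    unfolding g_def
  proof (intro measurable_restrict borel_measurable_sum)
    fix t i assume "t \<in> T" "i \<in> {..<Suc (k t)}"
    then have "i \<in> {..<n}" using k(1)[of t] by auto
    then show "(\<lambda>d. d i) \<in> borel_measurable (PiM {..<n} (\<lambda>_. borel))" by measurable
  qed
  \<comment> \<open>The right-hand side sees the process only through its marginals; an arbitrary
    process is taken so that both \<open>X\<close> and \<open>Y\<close> can be inserted.\<close>
  have repr: "distr K (PiM T (\<lambda>_. borel)) (\<lambda>\<omega>. \<lambda>t\<in>T. Z t \<omega>) =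
      distr (PiM {..<n} (\<lambda>i. distr K borel (Z (\<tau> (Suc i) - \<tau> i)))) (PiM T (\<lambda>_. borel)) g"
    if Z: "levy_process K Z" for K :: "'k measure" and Z :: "real \<Rightarrow> 'k \<Rightarrow> real"
  proof -
    interpret K: prob_space K using levy_process_prob_space[OF Z] .
    note [measurable] = levy_process_measurable[OF Z]
    define D where "D \<omega> = (\<lambda>i\<in>{..<n}. Z (\<tau> (Suc i)) \<omega> - Z (\<tau> i) \<omega>)" for \<omega>
    have [measurable]: "D \<in> K \<rightarrow>\<^sub>M PiM {..<n} (\<lambda>_. borel)"
      unfolding D_def using nn by (intro measurable_restrict borel_measurable_diff levy_process_measurable[OF Z]) auto
    have "distr K (PiM T (\<lambda>_. borel)) (\<lambda>\<omega>. \<lambda>t\<in>T. Z t \<omega>) = distr K (PiM T (\<lambda>_. borel)) (\<lambda>\<omega>. g (D \<omega>))"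
    proof (rule distr_cong_AE)
      show "AE \<omega> in K. (\<lambda>t\<in>T. Z t \<omega>) = g (D \<omega>)"
        using levy_process_zero[OF Z]
      proof eventually_elim
        fix \<omega> assume 0: "Z 0 \<omega> = 0"
        have "(\<Sum>i<Suc (k t). D \<omega> i) = Z t \<omega>" if t: "t \<in> T" for t
        proof -
          have "(\<Sum>i<Suc (k t). D \<omega> i) = (\<Sum>i<Suc (k t). Z (\<tau> (Suc i)) \<omega> - Z (\<tau> i) \<omega>)"
            using k(1)[OF t] by (intro sum.cong) (auto simp: D_def)
          also have "\<dots> = Z (\<tau> (Suc (k t))) \<omega> - Z (\<tau> 0) \<omega>"
            by (rule sum_lessThan_telescope)
          finally show ?thesis using k(2)[OF t] 0 by (simp add: \<tau>_def)
        qed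
        then show "(\<lambda>t\<in>T. Z t \<omega>) = g (D \<omega>)" by (auto simp: g_def)
      qed
      show "(\<lambda>\<omega>. \<lambda>t\<in>T. Z t \<omega>) \<in> K \<rightarrow>\<^sub>M PiM T (\<lambda>_. borel)"
        using T by (intro measurable_restrict levy_process_measurable[OF Z]) auto
    qed simp_all
    also have "\<dots> = distr (distr K (PiM {..<n} (\<lambda>_. borel)) D) (PiM T (\<lambda>_. borel)) g"
      by (simp add: distr_distr comp_def)
    also have "distr K (PiM {..<n} (\<lambda>_. borel)) D = PiM {..<n} (\<lambda>i. distr K borel (Z (\<tau> (Suc i) - \<tau> i)))"
      unfolding D_def[abs_def] using \<tau>0 \<tau>mono \<open>n > 0\<close> by (rule levy_process_increments_distr[OF Z])
    finally show ?thesis .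
  qed
  \<comment> \<open>If 0 is among the times, the first increment has length 0, so the marginals at
    time 0 are compared as well.\<close>
  have "distr M borel (X t) = distr N borel (Y t)" if "t \<ge> 0" for t
    using marg[of t] that levy_process_distr_0[OF X] levy_process_distr_0[OF Y] by (cases "t = 0") auto
  then have "PiM {..<n} (\<lambda>i. distr M borel (X (\<tau> (Suc i) - \<tau> i))) = PiM {..<n} (\<lambda>i. distr N borel (Y (\<tau> (Suc i) - \<tau> i)))"
    using \<tau>mono by (intro PiM_cong) auto
  then show ?thesis using repr[OF X] repr[OF Y] by simp
qed

section \<open>Cumulant generating functions and exponential tilting\<close>

lemma mgf_pos:
  assumes "prob_space P" "\<theta> \<in> cgf_dom P"
  shows "(\<integral>x. exp (\<theta> * x) \<partial>P) > 0"
  using assms by (intro prob_space.expectation_greater) (auto simp: cgf_dom_def)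

lemma exp_cgf:
  assumes "prob_space P" "\<theta> \<in> cgf_dom P"
  shows "exp (cgf P \<theta>) = (\<integral>x. exp (\<theta> * x) \<partial>P)"
  unfolding cgf_def using mgf_pos[OF assms] by simp

lemma nn_integral_exp_cgf:
  assumes "prob_space P" "\<theta> \<in> cgf_dom P"
  shows "(\<integral>\<^sup>+x. ennreal (exp (\<theta> * x)) \<partial>P) = ennreal (exp (cgf P \<theta>))"
  unfolding exp_cgf[OF assms] using assms
  by (intro nn_integral_eq_integral) (auto simp: cgf_dom_def)

text \<open>The integral is computed in \<open>ennreal\<close>, so membership in the domain comes
  out of the computation and need not be known before it.\<close>

lemma cgf_eqI:
  assumes "sets P = sets borel" and eq: "(\<integral>\<^sup>+x. ennreal (exp (\<theta> * x)) \<partial>P) = ennreal (exp y)"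
  shows "\<theta> \<in> cgf_dom P" "cgf P \<theta> = y"
proof -
  note [measurable_cong] = assms(1)
  show "\<theta> \<in> cgf_dom P" using eq by (simp add: cgf_dom_nn[OF assms(1)])
  have "(\<integral>x. exp (\<theta> * x) \<partial>P) = exp y"
    by (rule integral_eq_nn_integral[THEN trans]) (use eq in auto)
  then show "cgf P \<theta> = y" by (simp add: cgf_def)
qed

lemma zero_in_cgf_dom:
  assumes "prob_space P" "sets P = sets borel"
  shows "0 \<in> cgf_dom P" "cgf P 0 = 0"
  using cgf_eqI[of P 0 0] assms by (simp_all add: prob_space.emeasure_space_1)

section \<open>Exponential tilting\<close>

definition tilt :: "real measure \<Rightarrow> real \<Rightarrow> real measure" where
  "tilt P \<theta> = density P (\<lambda>x. ennreal (exp (\<theta> * x - cgf P \<theta>)))"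

lemma sets_tilt [simp]: "sets (tilt P \<theta>) = sets P"
  by (simp add: tilt_def)

lemma nn_integral_tilt:
  assumes "sets P = sets borel"
  shows "(\<integral>\<^sup>+x. ennreal (exp (s * x)) \<partial>tilt P \<theta>) =
    ennreal (exp (- cgf P \<theta>)) * (\<integral>\<^sup>+x. ennreal (exp ((\<theta> + s) * x)) \<partial>P)"
proof -
  note [measurable_cong] = assms(1)
  have "(\<integral>\<^sup>+x. ennreal (exp (s * x)) \<partial>tilt P \<theta>) =
      (\<integral>\<^sup>+x. ennreal (exp (\<theta> * x - cgf P \<theta>)) * ennreal (exp (s * x)) \<partial>P)"
    unfolding tilt_def by (intro nn_integral_density) measurable
  also have "\<dots> = (\<integral>\<^sup>+x. ennreal (exp (- cgf P \<theta>)) * ennreal (exp ((\<theta> + s) * x)) \<partial>P)"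
    by (intro nn_integral_cong)
      (simp add: ennreal_mult[symmetric] exp_add[symmetric] algebra_simps)
  also have "\<dots> = ennreal (exp (- cgf P \<theta>)) * (\<integral>\<^sup>+x. ennreal (exp ((\<theta> + s) * x)) \<partial>P)"
    by (intro nn_integral_cmult) measurable
  finally show ?thesis .
qed

lemma cgf_dom_tilt:
  assumes "sets P = sets borel"
  shows "s \<in> cgf_dom (tilt P \<theta>) \<longleftrightarrow> \<theta> + s \<in> cgf_dom P"
  using assms by (auto simp: cgf_dom_nn nn_integral_tilt ennreal_mult_less_top)

lemma cgf_tilt:
  assumes "prob_space P" "sets P = sets borel" "\<theta> + s \<in> cgf_dom P"
  shows "cgf (tilt P \<theta>) s = cgf P (\<theta> + s) - cgf P \<theta>"
proof (rule cgf_eqI(2))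
  show "(\<integral>\<^sup>+x. ennreal (exp (s * x)) \<partial>tilt P \<theta>) = ennreal (exp (cgf P (\<theta> + s) - cgf P \<theta>))"
    unfolding nn_integral_tilt[OF assms(2)] nn_integral_exp_cgf[OF assms(1,3)]
    by (simp add: ennreal_mult[symmetric] exp_add[symmetric])
qed (use assms in simp)

lemma prob_space_tilt:
  assumes "prob_space P" "sets P = sets borel" "\<theta> \<in> cgf_dom P"
  shows "prob_space (tilt P \<theta>)"
proof
  have "(\<integral>\<^sup>+x. ennreal (exp (0 * x)) \<partial>tilt P \<theta>) = 1"
    unfolding nn_integral_tilt[OF assms(2)] using nn_integral_exp_cgf[OF assms(1,3)]
    by (simp add: ennreal_mult[symmetric] exp_add[symmetric])
  then show "emeasure (tilt P \<theta>) (space (tilt P \<theta>)) = 1" by simp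
qed

lemma real_distribution_eqI_cgf:
  assumes A: "prob_space A" "sets A = sets borel" and B: "prob_space B" "sets B = sets borel"
    and "open S" "S \<noteq> {}"
    and S: "\<And>s. s \<in> S \<Longrightarrow> s \<in> cgf_dom A \<and> s \<in> cgf_dom B \<and> cgf A s = cgf B s"
  shows "A = B"
proof -
  obtain s e where se: "s \<in> S" "e > 0" "ball s e \<subseteq> S"
    using \<open>open S\<close> \<open>S \<noteq> {}\<close> by (meson all_not_in_conv openE)
  have sub: "{s - e<..<s + e} \<subseteq> S"
    using se(3) by (auto simp: ball_def dist_real_def subset_iff)
  show ?thesis
  proof (rule real_distribution_eqI_mgf[OF A B, of "s - e" "s + e"])
    show "{s - e<..<s + e} \<subseteq> cgf_dom A" "{s - e<..<s + e} \<subseteq> cgf_dom B"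
      using sub S by blast+
    fix r assume "s - e < r" "r < s + e"
    then have "r \<in> S" using sub by auto
    with S show "(\<integral>x. exp (r * x) \<partial>A) = (\<integral>x. exp (r * x) \<partial>B)"
      using exp_cgf[OF A(1)] exp_cgf[OF B(1)] by metis
  qed (use se in simp)
qed

section \<open>Derivatives of \<kappa> as mean and variance of the tilted law\<close>

definition cgf1 :: "real measure \<Rightarrow> real \<Rightarrow> real" where
  "cgf1 P \<theta> = tilted_moment P 1 \<theta> / tilted_moment P 0 \<theta>"

text \<open>Second moment minus squared mean of the law tilted at \<theta>: its variance, and the
  explicit form of \<open>\<kappa>''\<close>.\<close>

definition cgf2 :: "real measure \<Rightarrow> real \<Rightarrow> real" where
  "cgf2 P \<theta> = tilted_moment P 2 \<theta> / tilted_moment P 0 \<theta> - (cgf1 P \<theta>)\<^sup>2"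

lemma tilted_moment_0_pos:
  assumes "prob_space P" "\<theta> \<in> interior (cgf_dom P)"
  shows "tilted_moment P 0 \<theta> > 0"
  using mgf_pos[of P \<theta>] assms interior_subset by (auto simp: tilted_moment_def)

lemma has_real_derivative_cgf:
  assumes "prob_space P" "sets P = sets borel" "\<theta> \<in> interior (cgf_dom P)"
  shows "(cgf P has_real_derivative cgf1 P \<theta>) (at \<theta>)"
proof -
  have "((\<lambda>t. ln (tilted_moment P 0 t)) has_real_derivative cgf1 P \<theta>) (at \<theta>)"
    using has_real_derivative_tilted_moment[OF assms(2,3), of 0] tilted_moment_0_pos[OF assms(1,3)]
    by (auto intro!: derivative_eq_intros simp: cgf1_def)
  then show ?thesis by (simp add: cgf_def[abs_def] tilted_moment_def)
qed

lemma deriv_cgf: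
  assumes "prob_space P" "sets P = sets borel" "\<theta> \<in> interior (cgf_dom P)"
  shows "deriv (cgf P) \<theta> = cgf1 P \<theta>"
  using has_real_derivative_cgf[OF assms] by (rule DERIV_imp_deriv)

lemma has_real_derivative_cgf1:
  assumes "prob_space P" "sets P = sets borel" "\<theta> \<in> interior (cgf_dom P)"
  shows "(cgf1 P has_real_derivative cgf2 P \<theta>) (at \<theta>)"
proof -
  note pos = tilted_moment_0_pos[OF assms(1,3)]
  have "((\<lambda>t. tilted_moment P 1 t / tilted_moment P 0 t) has_real_derivative
      (tilted_moment P 2 \<theta> * tilted_moment P 0 \<theta> - tilted_moment P 1 \<theta> * tilted_moment P 1 \<theta>) /
      (tilted_moment P 0 \<theta> * tilted_moment P 0 \<theta>)) (at \<theta>)"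
    using has_real_derivative_tilted_moment[OF assms(2,3), of 0]
      has_real_derivative_tilted_moment[OF assms(2,3), of 1] pos
    by (intro DERIV_divide) (auto simp: numeral_2_eq_2)
  also have "(tilted_moment P 2 \<theta> * tilted_moment P 0 \<theta> - tilted_moment P 1 \<theta> * tilted_moment P 1 \<theta>) /
      (tilted_moment P 0 \<theta> * tilted_moment P 0 \<theta>) = cgf2 P \<theta>"
    using pos by (simp add: cgf2_def cgf1_def power2_eq_square diff_divide_distrib)
  finally show ?thesis by (simp add: cgf1_def[abs_def])
qed

lemma mean_variance_cgf:
  assumes "prob_space Q" "sets Q = sets borel" "0 \<in> interior (cgf_dom Q)"
  shows "(\<integral>x. x \<partial>Q) = cgf1 Q 0" "(\<integral>x. (x - (\<integral>x. x \<partial>Q))\<^sup>2 \<partial>Q) = cgf2 Q 0"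
    and "integrable Q (\<lambda>x. (x - a)\<^sup>2)"
proof -
  interpret prob_space Q by fact
  have i: "integrable Q (\<lambda>x. x)" "integrable Q (\<lambda>x. x\<^sup>2)"
    using integrable_tilted_moment[OF assms(2,3), of 1] integrable_tilted_moment[OF assms(2,3), of 2]
    by simp_all
  have 0: "tilted_moment Q 0 0 = 1" using prob_space by (simp add: tilted_moment_def)
  show 1: "(\<integral>x. x \<partial>Q) = cgf1 Q 0"
    using 0 by (simp add: cgf1_def) (simp add: tilted_moment_def)
  show "(\<integral>x. (x - (\<integral>x. x \<partial>Q))\<^sup>2 \<partial>Q) = cgf2 Q 0"
    using variance_eq[OF i] 0 1 by (simp add: cgf2_def) (simp add: tilted_moment_def)
  show "integrable Q (\<lambda>x. (x - a)\<^sup>2)"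
    unfolding power2_diff using i by simp
qed

lemma mean_variance_of_cgf_eq:
  fixes F F1 :: "real \<Rightarrow> real"
  assumes Q: "prob_space Q" "sets Q = sets borel" and S: "open S" "0 \<in> S" "S \<subseteq> cgf_dom Q"
    and F: "\<And>s. s \<in> S \<Longrightarrow> cgf Q s = F s"
    and F1: "\<And>s. s \<in> S \<Longrightarrow> (F has_real_derivative F1 s) (at s)"
    and F2: "(F1 has_real_derivative F2) (at 0)"
  shows "(\<integral>x. x \<partial>Q) = F1 0" "(\<integral>x. (x - (\<integral>x. x \<partial>Q))\<^sup>2 \<partial>Q) = F2"
proof -
  have int: "S \<subseteq> interior (cgf_dom Q)" using S by (intro interior_maximal) auto
  have 1: "cgf1 Q s = F1 s" if "s \<in> S" for s
  proof (rule DERIV_unique)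
    show "(F has_real_derivative cgf1 Q s) (at s)"
      using has_real_derivative_cgf[OF Q, of s] int that
      by (rule_tac has_field_derivative_transform_within_open[OF _ \<open>open S\<close> that, of "cgf Q"]) (auto simp: F)
  qed (rule F1[OF that])
  have 2: "cgf2 Q 0 = F2"
  proof (rule DERIV_unique)
    show "(F1 has_real_derivative cgf2 Q 0) (at 0)"
      using has_real_derivative_cgf1[OF Q, of 0] int S
      by (rule_tac has_field_derivative_transform_within_open[OF _ \<open>open S\<close> \<open>0 \<in> S\<close>, of "cgf1 Q"]) (auto simp: 1)
  qed (rule F2)
  have "0 \<in> interior (cgf_dom Q)" using int S by auto
  from mean_variance_cgf[OF Q this] 1[of 0] 2 S
  show "(\<integral>x. x \<partial>Q) = F1 0" "(\<integral>x. (x - (\<integral>x. x \<partial>Q))\<^sup>2 \<partial>Q) = F2" by auto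
qed

lemma interior_shift_scale:
  fixes D :: "real set"
  assumes "t > 0" "\<theta> \<in> interior D"
  shows "open {s. \<theta> + s / t \<in> interior D}" "0 \<in> {s. \<theta> + s / t \<in> interior D}"
  using assms by (auto intro!: open_vimage[of "interior D" "\<lambda>s. \<theta> + s / t", unfolded vimage_def] continuous_intros)

text \<open>Serves both the tilt itself (\<open>t = 1\<close>) and the law of \<open>X t / t\<close>
  in the dispersion model. Each differentiation in \<open>s\<close> brings a factor
  \<open>1 / t\<close> against the prefactor \<open>t\<close>, so the mean is unchanged and the
  variance is divided by \<open>t\<close>.\<close>

lemma scaled_cgf_moments:
  assumes P: "prob_space P" "sets P = sets borel" and \<theta>: "\<theta> \<in> interior (cgf_dom P)" and "t > 0"
    and Q: "prob_space Q" "sets Q = sets borel"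
    and dom: "\<And>s. \<theta> + s / t \<in> cgf_dom P \<Longrightarrow> s \<in> cgf_dom Q"
    and cgf: "\<And>s. \<theta> + s / t \<in> cgf_dom P \<Longrightarrow> cgf Q s = t * (cgf P (\<theta> + s / t) - cgf P \<theta>)"
  shows "(\<integral>x. x \<partial>Q) = cgf1 P \<theta>" "(\<integral>x. (x - (\<integral>x. x \<partial>Q))\<^sup>2 \<partial>Q) = cgf2 P \<theta> / t"
proof -
  let ?S = "{s. \<theta> + s / t \<in> interior (cgf_dom P)}"
  note S = interior_shift_scale[OF \<open>t > 0\<close> \<theta>]
  have int: "s \<in> ?S \<Longrightarrow> \<theta> + s / t \<in> cgf_dom P" for s using interior_subset by auto
  have d1: "((\<lambda>s. t * (cgf P (\<theta> + s / t) - cgf P \<theta>)) has_real_derivative cgf1 P (\<theta> + s / t)) (at s)"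
    if "s \<in> ?S" for s
  proof -
    have "((\<lambda>s. cgf P (\<theta> + s / t)) has_real_derivative cgf1 P (\<theta> + s / t) * (1 / t)) (at s)"
      by (rule DERIV_chain2[OF has_real_derivative_cgf[OF P]])
        (use that \<open>t > 0\<close> in \<open>auto intro!: derivative_eq_intros\<close>)
    then show ?thesis using \<open>t > 0\<close> by (auto intro!: derivative_eq_intros)
  qed
  have d2: "((\<lambda>s. cgf1 P (\<theta> + s / t)) has_real_derivative cgf2 P \<theta> / t) (at 0)"
  proof -
    have "((\<lambda>s. cgf1 P (\<theta> + s / t)) has_real_derivative cgf2 P (\<theta> + 0 / t) * (1 / t)) (at 0)"
      by (rule DERIV_chain2[OF has_real_derivative_cgf1[OF P]])
        (use \<theta> \<open>t > 0\<close> in \<open>auto intro!: derivative_eq_intros\<close>)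
    then show ?thesis by simp
  qed
  note * = mean_variance_of_cgf_eq[OF Q S _ _ d1 d2]
  show "(\<integral>x. x \<partial>Q) = cgf1 P \<theta>" using int dom cgf by (subst *(1)) auto
  show "(\<integral>x. (x - (\<integral>x. x \<partial>Q))\<^sup>2 \<partial>Q) = cgf2 P \<theta> / t" using int dom cgf by (intro *(2)) auto
qed

lemma tilt_moments:
  assumes P: "prob_space P" "sets P = sets borel" and \<theta>: "\<theta> \<in> interior (cgf_dom P)"
  shows "(\<integral>x. x \<partial>tilt P \<theta>) = cgf1 P \<theta>"
    "(\<integral>x. (x - (\<integral>x. x \<partial>tilt P \<theta>))\<^sup>2 \<partial>tilt P \<theta>) = cgf2 P \<theta>"
  using scaled_cgf_moments[OF P \<theta>, of 1 "tilt P \<theta>"] P \<theta> interior_subset[of "cgf_dom P"]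
  by (auto simp: cgf_dom_tilt cgf_tilt prob_space_tilt)

text \<open>Zero variance makes the tilted law a point mass; its density is strictly positive, so
  the same null sets serve for \<open>P\<close>.\<close>

lemma cgf2_eq_0_imp_constant:
  assumes P: "prob_space P" "sets P = sets borel" and \<theta>: "\<theta> \<in> interior (cgf_dom P)"
    and "cgf2 P \<theta> = 0"
  shows "AE x in P. x = cgf1 P \<theta>"
proof -
  have \<theta>': "\<theta> \<in> cgf_dom P" using \<theta> interior_subset by auto
  note [measurable_cong] = P(2)
  have Q: "prob_space (tilt P \<theta>)" "sets (tilt P \<theta>) = sets borel"
    using prob_space_tilt[OF P \<theta>'] P by auto
  have int: "0 \<in> interior (cgf_dom (tilt P \<theta>))"
  proof (rule interiorI)
    show "open {s. \<theta> + s / 1 \<in> interior (cgf_dom P)}" "0 \<in> {s. \<theta> + s / 1 \<in> interior (cgf_dom P)}"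
      by (rule interior_shift_scale; use \<theta> in simp)+
    show "{s. \<theta> + s / 1 \<in> interior (cgf_dom P)} \<subseteq> cgf_dom (tilt P \<theta>)"
      using interior_subset[of "cgf_dom P"] by (auto simp: cgf_dom_tilt[OF P(2)])
  qed
  have "(\<integral>x. (x - cgf1 P \<theta>)\<^sup>2 \<partial>tilt P \<theta>) = 0"
    using tilt_moments[OF P \<theta>] assms(4) by simp
  then have "AE x in tilt P \<theta>. (x - cgf1 P \<theta>)\<^sup>2 = 0"
    using mean_variance_cgf(3)[OF Q int] by (subst (asm) integral_nonneg_eq_0_iff_AE) auto
  then show ?thesis
    unfolding tilt_def by (subst (asm) AE_density) auto
qed

text \<open>Unlike differentiability, continuity includes the endpoints that belong to the domain.
  It fixes the value of \<kappa> at the singular endpoint.\<close>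

lemma continuous_on_cgf:
  assumes P: "prob_space P" "sets P = sets borel" and ab: "a \<in> cgf_dom P" "b \<in> cgf_dom P"
  shows "continuous_on {a..b} (cgf P)"
proof -
  note [measurable_cong] = P(2)
  have dom: "t \<in> cgf_dom P" if "t \<in> {a..b}" for t
    using convex_cgf_dom[OF P(2)] ab that
    by (meson atLeastAtMost_iff is_interval_1 is_interval_convex_1)
  have "continuous_on {a..b} (\<lambda>\<theta>. \<integral>x. exp (\<theta> * x) \<partial>P)"
  proof (rule continuous_on_sequentiallyI)
    fix u t assume u: "\<forall>n. u n \<in> {a..b}" and t: "t \<in> {a..b}" and lim: "u \<longlonglongrightarrow> t"
    show "(\<lambda>n. \<integral>x. exp (u n * x) \<partial>P) \<longlonglongrightarrow> (\<integral>x. exp (t * x) \<partial>P)"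
    proof (rule integral_dominated_convergence[where w = "\<lambda>x. exp (a * x) + exp (b * x)"])
      show "integrable P (\<lambda>x. exp (a * x) + exp (b * x))" using ab by (auto simp: cgf_dom_def)
      show "AE x in P. (\<lambda>n. exp (u n * x)) \<longlonglongrightarrow> exp (t * x)"
        using lim by (intro always_eventually allI tendsto_intros)
      show "AE x in P. norm (exp (u n * x)) \<le> exp (a * x) + exp (b * x)" for n
        using u exp_mult_le_endpoints[of a "u n" b] by (intro always_eventually allI) simp
    qed measurable
  qed
  then show ?thesis
    unfolding cgf_def[abs_def] using dom mgf_pos[OF P(1)]
    by (intro continuous_on_ln) force+
qed

text \<open>Fatou's lemma. This is how a boundary point is shown to belong to \<Theta>.\<close>

lemma cgf_dom_limit:
  assumes P: "prob_space P" "sets P = sets borel" and lim: "u \<longlonglongrightarrow> \<theta>"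
    and u: "\<And>n. u n \<in> cgf_dom P" "\<And>n. cgf P (u n) \<le> B"
  shows "\<theta> \<in> cgf_dom P"
proof -
  note [measurable_cong] = P(2)
  have "(\<integral>\<^sup>+x. ennreal (exp (\<theta> * x)) \<partial>P) = (\<integral>\<^sup>+x. liminf (\<lambda>n. ennreal (exp (u n * x))) \<partial>P)"
  proof (rule nn_integral_cong)
    fix x
    have "(\<lambda>n. ennreal (exp (u n * x))) \<longlonglongrightarrow> ennreal (exp (\<theta> * x))"
      using lim by (intro tendsto_intros)
    then show "ennreal (exp (\<theta> * x)) = liminf (\<lambda>n. ennreal (exp (u n * x)))"
      by (rule lim_imp_Liminf[OF sequentially_bot, symmetric])
  qed
  also have "\<dots> \<le> liminf (\<lambda>n. \<integral>\<^sup>+x. ennreal (exp (u n * x)) \<partial>P)"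
    by (rule nn_integral_liminf) measurable
  also have "\<dots> \<le> liminf (\<lambda>n. ennreal (exp B))"
    unfolding nn_integral_exp_cgf[OF P(1) u(1)] using u(2)
    by (intro Liminf_mono always_eventually) (auto intro!: ennreal_leI)
  also have "\<dots> < \<infinity>" by (simp add: Liminf_const)
  finally show ?thesis by (simp add: cgf_dom_nn[OF P(2)])
qed

section \<open>Marginals of a Levy process whose time-one law is a tilt\<close>

lemma levy_process_marginal:
  assumes "levy_process M X" "t \<ge> 0"
  shows "prob_space (distr M borel (X t))"
  using prob_space.prob_space_distr[OF levy_process_prob_space levy_process_measurable] assms by blast

lemma nn_integral_exp_marginal:
  assumes "levy_process M X" "t \<ge> 0"
  shows "(\<integral>\<^sup>+x. ennreal (exp (s * x)) \<partial>distr M borel (X t)) = levy_mgf M X s t"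
  unfolding levy_mgf_def using levy_process_measurable[OF assms]
  by (subst nn_integral_distr) auto

text \<open>Finiteness of the transform does not depend on the positive time, so every marginal has
  the domain of the time-one law, which is \<Theta> shifted by \<theta>.\<close>

lemma levy_tilted_cgf_dom:
  assumes X: "levy_process M X" and P: "prob_space P" "sets P = sets borel" and \<theta>: "\<theta> \<in> cgf_dom P"
    and law: "distr M borel (X 1) = tilt P \<theta>" and "t > 0"
  shows "s \<in> cgf_dom (distr M borel (X t)) \<longleftrightarrow> \<theta> + s \<in> cgf_dom P"
proof -
  have "s \<in> cgf_dom (distr M borel (X t)) \<longleftrightarrow> levy_mgf M X s t < \<infinity>"
    using \<open>t > 0\<close> by (simp add: cgf_dom_nn nn_integral_exp_marginal[OF X])
  also have "\<dots> \<longleftrightarrow> levy_mgf M X s 1 < \<infinity>"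
    using levy_mgf_finite[OF X, of t 1 s] levy_mgf_finite[OF X, of 1 t s] \<open>t > 0\<close> by auto
  also have "\<dots> \<longleftrightarrow> s \<in> cgf_dom (distr M borel (X 1))"
    by (simp add: cgf_dom_nn nn_integral_exp_marginal[OF X])
  also have "\<dots> \<longleftrightarrow> \<theta> + s \<in> cgf_dom P"
    unfolding law by (rule cgf_dom_tilt[OF P(2)])
  finally show ?thesis .
qed

lemma levy_tilted_cgf:
  assumes X: "levy_process M X" and P: "prob_space P" "sets P = sets borel" and \<theta>: "\<theta> \<in> cgf_dom P"
    and law: "distr M borel (X 1) = tilt P \<theta>" and "t > 0" and s: "\<theta> + s \<in> cgf_dom P"
  shows "cgf (distr M borel (X t)) s = t * (cgf P (\<theta> + s) - cgf P \<theta>)"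
proof (rule cgf_eqI)
  have "s \<in> cgf_dom (tilt P \<theta>)" using s by (simp add: cgf_dom_tilt[OF P(2)])
  then have "levy_mgf M X s 1 = ennreal (exp (cgf P (\<theta> + s) - cgf P \<theta>))"
    using nn_integral_exp_marginal[OF X, of 1 s] nn_integral_exp_cgf[OF prob_space_tilt[OF P \<theta>], of s]
    by (simp add: law cgf_tilt[OF P s])
  with levy_mgf_exponent[OF X, of s t] \<open>t > 0\<close>
  show "(\<integral>\<^sup>+x. ennreal (exp (s * x)) \<partial>distr M borel (X t)) = ennreal (exp (t * (cgf P (\<theta> + s) - cgf P \<theta>)))"
    by (simp add: nn_integral_exp_marginal[OF X])
qed simp

section \<open>Families with logarithmic mean map\<close>

lemma tendsto_x_ln_x_minus_x_at_right_0: "((\<lambda>x::real. x * ln x - x) \<longlongrightarrow> 0) (at_right 0)"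
  by real_asymp

text \<open>Differentiating \<open>cgf1_eq\<close> gives the variance
  \<open>(a / b) * exp (b * m)\<close> at mean \<open>m\<close>, and \<open>a * b > 0\<close> is
  positivity of its coefficient. The sign of \<open>a\<close> tells on which side of
  \<open>\<theta>\<^sub>0\<close> the domain lies.\<close>

locale log_mean_family = prob_space P for P :: "real measure" +
  fixes a b :: real and \<theta>\<^sub>0 :: real
  assumes sets_P: "sets P = sets borel"
    and int_nonempty: "interior (cgf_dom P) \<noteq> {}"
    and ab: "a * b > 0"
    and int_pos: "\<And>\<theta>. \<theta> \<in> interior (cgf_dom P) \<Longrightarrow> a * (\<theta>\<^sub>0 - \<theta>) > 0"
    and cgf1_eq: "\<And>\<theta>. \<theta> \<in> interior (cgf_dom P) \<Longrightarrow> cgf1 P \<theta> = - ln (a * (\<theta>\<^sub>0 - \<theta>)) / b"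
begin

abbreviation U :: "real \<Rightarrow> real" where "U \<theta> \<equiv> a * (\<theta>\<^sub>0 - \<theta>)"

lemma P: "prob_space P" "sets P = sets borel"
  by (rule prob_space_axioms) (rule sets_P)

lemma a_nz: "a \<noteq> 0" and b_nz: "b \<noteq> 0"
  using ab by auto

lemma closure_int: "cgf_dom P \<subseteq> closure (interior (cgf_dom P))"
  using convex_closure_interior[OF convex_cgf_dom[OF sets_P] int_nonempty] closure_subset by auto

lemma dom_nonneg:
  assumes "\<theta> \<in> cgf_dom P"
  shows "U \<theta> \<ge> 0"
proof -
  have "closed {\<theta>. U \<theta> \<ge> 0}" by (intro closed_Collect_le continuous_intros)
  then have "closure (interior (cgf_dom P)) \<subseteq> {\<theta>. U \<theta> \<ge> 0}"
    using int_pos less_imp_le by (intro closure_minimal) blast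
  then show ?thesis using assms closure_int by auto
qed

text \<open>\<open>Lim\<close> is determined only along a nontrivial filter; by convexity a domain
  point off the interior is still a limit point of it.\<close>

lemma endpoint_nontrivial:
  assumes "\<theta> \<in> cgf_dom P" "\<theta> \<notin> interior (cgf_dom P)"
  shows "at \<theta> within interior (cgf_dom P) \<noteq> bot"
  using assms closure_int by (auto simp: trivial_limit_within closure_def)

lemma mean_map_Lim:
  assumes "\<theta> \<in> cgf_dom P" "\<theta> \<notin> interior (cgf_dom P)"
    and "((\<lambda>x. ereal (- ln (U x) / b)) \<longlongrightarrow> l) (at \<theta> within interior (cgf_dom P))"
  shows "mean_map P \<theta> = l"
proof -
  have "((\<lambda>x. ereal (deriv (cgf P) x)) \<longlongrightarrow> l) (at \<theta> within interior (cgf_dom P))"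
    by (rule Lim_transform_eventually[OF assms(3)])
      (auto simp: eventually_at_filter deriv_cgf[OF P] cgf1_eq)
  then show ?thesis
    unfolding mean_map_def using assms(2) tendsto_Lim[OF endpoint_nontrivial[OF assms(1,2)]] by auto
qed

lemma mean_map_interior:
  assumes "\<theta> \<in> interior (cgf_dom P)"
  shows "mean_map P \<theta> = ereal (- ln (U \<theta>) / b)"
  using assms by (simp add: mean_map_def deriv_cgf[OF P] cgf1_eq)

text \<open>At this stage the domain may still end at a point where \<open>U\<close> is positive;
  there \<open>mean_map\<close> is a limit, and continuity of the logarithm gives the same
  formula.\<close>

lemma mean_map_pos:
  assumes "\<theta> \<in> cgf_dom P" "U \<theta> > 0"
  shows "mean_map P \<theta> = ereal (- ln (U \<theta>) / b)"
proof (cases "\<theta> \<in> interior (cgf_dom P)")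
  case False
  show ?thesis
    by (rule mean_map_Lim[OF assms(1) False]) (use assms(2) b_nz in \<open>auto intro!: tendsto_intros\<close>)
qed (rule mean_map_interior)

text \<open>\<open>U\<close> tends to 0 through positive values, so \<open>- ln U\<close> diverges
  to infinity and the sign of \<open>b\<close> selects the infinite mean.\<close>

lemma mean_map_zero:
  assumes "\<theta>\<^sub>0 \<in> cgf_dom P"
  shows "mean_map P \<theta>\<^sub>0 = (if b > 0 then \<infinity> else - \<infinity>)"
proof (rule mean_map_Lim[OF assms])
  show "\<theta>\<^sub>0 \<notin> interior (cgf_dom P)" using int_pos[of \<theta>\<^sub>0] by auto
  have "(U \<longlongrightarrow> U \<theta>\<^sub>0) (at \<theta>\<^sub>0 within interior (cgf_dom P))"
    by (intro tendsto_intros)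
  then have U: "filterlim U (at_right 0) (at \<theta>\<^sub>0 within interior (cgf_dom P))"
    by (auto simp: filterlim_at eventually_at_filter int_pos a_nz)
  show "((\<lambda>x. ereal (- ln (U x) / b)) \<longlongrightarrow> (if b > 0 then \<infinity> else - \<infinity>))
      (at \<theta>\<^sub>0 within interior (cgf_dom P))"
  proof (cases "b > 0")
    case True
    have "filterlim (\<lambda>x. - ln x / b) at_top (at_right 0)" using True by real_asymp
    from filterlim_compose[OF this U] True show ?thesis by (simp add: tendsto_PInfty_eq_at_top)
  next
    case False
    then have "b < 0" using b_nz by simp
    then have "filterlim (\<lambda>x. - (- ln x / b)) at_top (at_right 0)" by real_asymp
    from filterlim_compose[OF this U]
    have "((\<lambda>x. - ereal (- ln (U x) / b)) \<longlongrightarrow> \<infinity>) (at \<theta>\<^sub>0 within interior (cgf_dom P))"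
      by (simp add: tendsto_PInfty_eq_at_top)
    with False show ?thesis using ereal_Lim_uminus by fastforce
  qed
qed

lemma U_inverse: "U (\<theta>\<^sub>0 - u / a) = u"
  using a_nz by simp

end

text \<open>If every real number occurs as a mean, then the family is full up to the singularity of the
  logarithm, which itself belongs to \<open>\<Theta>\<close> because \<open>u ln u\<close> stays bounded as \<open>u \<rightarrow> 0\<close>.\<close>

locale full_log_mean_family = log_mean_family +
  assumes all_means: "\<And>y. \<exists>\<theta>\<in>cgf_dom P. mean_map P \<theta> = ereal y"
begin

text \<open>The finite mean that the formula predicts at \<theta> occurs at some \<eta> in the
  domain. This \<eta> is not \<open>\<theta>\<^sub>0\<close>, whose mean is infinite, so injectivity
  of the logarithm gives \<open>\<eta> = \<theta>\<close>.\<close>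

lemma pos_dom:
  assumes "U \<theta> > 0"
  shows "\<theta> \<in> cgf_dom P"
proof -
  obtain \<eta> where \<eta>: "\<eta> \<in> cgf_dom P" "mean_map P \<eta> = ereal (- ln (U \<theta>) / b)"
    using all_means by blast
  have "U \<eta> \<noteq> 0"
  proof
    assume "U \<eta> = 0"
    then have "\<eta> = \<theta>\<^sub>0" using a_nz by simp
    then show False using \<eta> mean_map_zero by (auto split: if_splits)
  qed
  then have pos: "U \<eta> > 0" using dom_nonneg[OF \<eta>(1)] by linarith
  then have "ln (U \<eta>) = ln (U \<theta>)" using \<eta>(2) mean_map_pos[OF \<eta>(1) pos] b_nz by simp
  then have "U \<eta> = U \<theta>" using pos assms by simp
  then have "\<eta> = \<theta>" using a_nz by simp
  then show ?thesis using \<eta> by simp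
qed

lemma interior_eq: "interior (cgf_dom P) = {\<theta>. U \<theta> > 0}"
proof
  have "open {\<theta>. U \<theta> > 0}" by (intro open_Collect_less continuous_intros)
  then show "{\<theta>. U \<theta> > 0} \<subseteq> interior (cgf_dom P)"
    using pos_dom by (intro interior_maximal) blast
qed (use int_pos in auto)

text \<open>Integrates \<open>\<kappa>' = - ln U / b\<close>: a primitive of \<open>ln u\<close> is
  \<open>u * ln u - u\<close>, and \<open>U\<close> has slope \<open>- a\<close>, whence the
  denominator \<open>a * b\<close>.\<close>

lemma cgf_interior:
  "\<exists>C. \<forall>\<theta>\<in>interior (cgf_dom P). cgf P \<theta> = (U \<theta> * ln (U \<theta>) - U \<theta>) / (a * b) + C"
proof -
  have "\<exists>C. \<forall>\<theta>\<in>interior (cgf_dom P). cgf P \<theta> - (U \<theta> * ln (U \<theta>) - U \<theta>) / (a * b) = C"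
  proof (rule has_field_derivative_zero_constant)
    show "convex (interior (cgf_dom P))" using convex_cgf_dom[OF sets_P] by (rule convex_interior)
    fix \<theta> assume \<theta>: "\<theta> \<in> interior (cgf_dom P)"
    show "((\<lambda>\<theta>. cgf P \<theta> - (U \<theta> * ln (U \<theta>) - U \<theta>) / (a * b)) has_real_derivative 0)
        (at \<theta> within interior (cgf_dom P))"
    proof (rule has_field_derivative_at_within)
      have "((\<lambda>u. u * ln u - u) has_real_derivative ln (U \<theta>)) (at (U \<theta>))"
        using int_pos[OF \<theta>] by (auto intro!: derivative_eq_intros)
      then have "((\<lambda>\<theta>. U \<theta> * ln (U \<theta>) - U \<theta>) has_real_derivative ln (U \<theta>) * - a) (at \<theta>)"
        by (rule DERIV_chain2) (auto intro!: derivative_eq_intros)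
      from DERIV_diff[OF has_real_derivative_cgf[OF P \<theta>] DERIV_cdivide[OF this, of "a * b"]]
      show "((\<lambda>\<theta>. cgf P \<theta> - (U \<theta> * ln (U \<theta>) - U \<theta>) / (a * b)) has_real_derivative 0) (at \<theta>)"
        unfolding cgf1_eq[OF \<theta>] using a_nz by simp
    qed
  qed
  then show ?thesis by (force simp: algebra_simps)
qed

lemma endpoint_sequence:
  defines "u \<equiv> \<lambda>n. \<theta>\<^sub>0 - inverse (real (Suc n)) / a"
  shows "u \<longlonglongrightarrow> \<theta>\<^sub>0" "u n \<in> interior (cgf_dom P)" "U (u n) = inverse (real (Suc n))"
proof -
  show U: "U (u n) = inverse (real (Suc n))" for n
    unfolding u_def by (rule U_inverse)
  then show "u n \<in> interior (cgf_dom P)" by (simp add: interior_eq)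
  have "u \<longlonglongrightarrow> \<theta>\<^sub>0 - 0 / a"
    unfolding u_def using a_nz by (intro tendsto_intros LIMSEQ_inverse_real_of_nat) auto
  then show "u \<longlonglongrightarrow> \<theta>\<^sub>0" by simp
qed

lemma endpoint_in_dom: "\<theta>\<^sub>0 \<in> cgf_dom P"
proof -
  obtain C where C: "\<And>\<theta>. \<theta> \<in> interior (cgf_dom P) \<Longrightarrow> cgf P \<theta> = (U \<theta> * ln (U \<theta>) - U \<theta>) / (a * b) + C"
    using cgf_interior by blast
  show ?thesis
  proof (rule cgf_dom_limit[OF P endpoint_sequence(1)])
    fix n
    define x where "x = inverse (real (Suc n))"
    have x: "0 < x" "x \<le> 1" by (auto simp: x_def field_simps)
    have "cgf P (\<theta>\<^sub>0 - x / a) = (x * ln x - x) / (a * b) + C"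
      using C[OF endpoint_sequence(2)[of n]] unfolding endpoint_sequence(3) x_def by simp
    \<comment> \<open>Nonpositivity on \<open>(0, 1]\<close> makes the constant \<open>C\<close> an
      upper bound of \<kappa> along the whole sequence.\<close>
    moreover have "x * ln x - x \<le> 0"
      using x mult_nonneg_nonpos[of x "ln x"] ln_le_zero_iff[of x] by linarith
    ultimately show "cgf P (\<theta>\<^sub>0 - inverse (real (Suc n)) / a) \<le> C"
      using ab by (simp add: x_def divide_nonpos_pos)
  qed (use endpoint_sequence(2) interior_subset in blast)
qed

lemma dom_eq: "cgf_dom P = {\<theta>. U \<theta> \<ge> 0}"
proof
  show "{\<theta>. U \<theta> \<ge> 0} \<subseteq> cgf_dom P"
  proof
    fix \<theta> assume "\<theta> \<in> {\<theta>. U \<theta> \<ge> 0}"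
    then consider "U \<theta> > 0" | "\<theta> = \<theta>\<^sub>0" using a_nz by fastforce
    then show "\<theta> \<in> cgf_dom P" using pos_dom endpoint_in_dom by cases auto
  qed
qed (use dom_nonneg in auto)

lemma cgf_eq: "\<exists>C. \<forall>\<theta>\<in>cgf_dom P. cgf P \<theta> = (U \<theta> * ln (U \<theta>) - U \<theta>) / (a * b) + C"
proof -
  obtain C where C: "\<And>\<theta>. \<theta> \<in> interior (cgf_dom P) \<Longrightarrow> cgf P \<theta> = (U \<theta> * ln (U \<theta>) - U \<theta>) / (a * b) + C"
    using cgf_interior by blast
  define u where "u n = \<theta>\<^sub>0 - inverse (real (Suc n)) / a" for n
  note u = endpoint_sequence[folded u_def]
  \<comment> \<open>The sign of \<open>a\<close> decides on which side of
    \<open>\<theta>\<^sub>0\<close> the sequence lies, so the interval for the continuity argument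
    is ordered by \<open>min\<close> and \<open>max\<close>.\<close>
  define lo hi where "lo = min (u 0) \<theta>\<^sub>0" and "hi = max (u 0) \<theta>\<^sub>0"
  have dom: "lo \<in> cgf_dom P" "hi \<in> cgf_dom P"
    using subsetD[OF interior_subset u(2)[of 0]] endpoint_in_dom
    by (simp_all add: lo_def hi_def min_def max_def)
  have mem: "u n \<in> {lo..hi}" for n
  proof -
    have "inverse (real (Suc n)) \<le> 1" by (simp add: field_simps)
    then show ?thesis
      using a_nz by (cases "a > 0") (auto simp: u_def lo_def hi_def min_le_iff_disj le_max_iff_disj
          divide_right_mono divide_right_mono_neg zero_le_divide_iff divide_le_0_iff)
  qed
  have "(\<lambda>n. cgf P (u n)) \<longlonglongrightarrow> cgf P \<theta>\<^sub>0"
    by (rule continuous_on_tendsto_compose[OF continuous_on_cgf[OF P dom] u(1)])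
      (use mem in \<open>auto simp: lo_def hi_def\<close>)
  moreover have "(\<lambda>n. cgf P (u n)) \<longlonglongrightarrow> 0 / (a * b) + C"
  proof -
    have *: "filterlim (\<lambda>n. inverse (real (Suc n))) (at_right 0) sequentially"
      using LIMSEQ_inverse_real_of_nat by (auto simp: filterlim_at)
    have "(\<lambda>n. (inverse (real (Suc n)) * ln (inverse (real (Suc n))) - inverse (real (Suc n))) / (a * b) + C)
        \<longlonglongrightarrow> 0 / (a * b) + C"
      using a_nz b_nz by (intro tendsto_intros filterlim_compose[OF tendsto_x_ln_x_minus_x_at_right_0 *]) auto
    then show ?thesis
      by (simp only: C[OF u(2)] u(3))
  qed
  ultimately have "cgf P \<theta>\<^sub>0 = C"
    using LIMSEQ_unique by fastforce
  then have "cgf P \<theta> = (U \<theta> * ln (U \<theta>) - U \<theta>) / (a * b) + C" if "\<theta> \<in> cgf_dom P" for \<theta>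
  proof (cases "U \<theta> > 0")
    \<comment> \<open>At \<open>U \<theta> = 0\<close> the product
      \<open>U \<theta> * ln (U \<theta>)\<close> is 0, which agrees with the limit of
      \<open>x * ln x\<close> at 0; so the formula reads \<open>C\<close> there.\<close>
    case False
    then have "U \<theta> = 0" using that dom_eq by auto
    then have "\<theta> = \<theta>\<^sub>0" using a_nz by simp
    then show ?thesis using \<open>cgf P \<theta>\<^sub>0 = C\<close> by simp
  next
    case True
    then show ?thesis using C interior_eq by blast
  qed
  then show ?thesis by blast
qed

lemma mean_map_image: "mean_map P ` cgf_dom P = hougaard_index_set b"
proof (intro set_eqI iffI)
  fix m assume "m \<in> mean_map P ` cgf_dom P"
  then obtain \<theta> where \<theta>: "\<theta> \<in> cgf_dom P" "m = mean_map P \<theta>" by blast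
  show "m \<in> hougaard_index_set b"
  proof (cases "U \<theta> > 0")
    case True
    then show ?thesis using \<theta> mean_map_pos by (auto simp: hougaard_index_set_def)
  next
    case False
    then have "U \<theta> = 0" using \<theta> dom_eq by auto
    then have "\<theta> = \<theta>\<^sub>0" using a_nz by simp
    then show ?thesis using \<theta> mean_map_zero by (auto simp: hougaard_index_set_def)
  qed
next
  fix m assume m: "m \<in> hougaard_index_set b"
  show "m \<in> mean_map P ` cgf_dom P"
  proof (cases m)
    case (real r)
    then show ?thesis using all_means[of r] by (metis image_eqI)
  qed (use m mean_map_zero[OF endpoint_in_dom] endpoint_in_dom in
        \<open>auto simp: hougaard_index_set_def split: if_splits intro!: image_eqI[of _ _ \<theta>\<^sub>0]\<close>)
qed

end

lemma full_log_mean_familyI: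
  assumes P: "prob_space P" "sets P = sets borel" and ne: "interior (cgf_dom P) \<noteq> {}"
    and v: "v > 0" and b: "b \<noteq> 0"
    and var: "\<And>\<theta>. \<theta> \<in> interior (cgf_dom P) \<Longrightarrow> cgf2 P \<theta> = v * exp (b * cgf1 P \<theta>)"
    and means: "\<And>y. \<exists>\<theta>\<in>cgf_dom P. mean_map P \<theta> = ereal y"
  obtains \<theta>\<^sub>0 where "full_log_mean_family P (b * v) b \<theta>\<^sub>0"
proof -
  have "\<exists>C. \<forall>\<theta>\<in>interior (cgf_dom P). exp (- b * cgf1 P \<theta>) + b * v * \<theta> = C"
  proof (rule has_field_derivative_zero_constant)
    show "convex (interior (cgf_dom P))" using convex_cgf_dom[OF P(2)] by (rule convex_interior)
    fix \<theta> assume \<theta>: "\<theta> \<in> interior (cgf_dom P)"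
    have "((\<lambda>\<theta>. exp (- b * cgf1 P \<theta>) + b * v * \<theta>) has_real_derivative
        exp (- b * cgf1 P \<theta>) * (- b * cgf2 P \<theta>) + b * v) (at \<theta>)"
      using has_real_derivative_cgf1[OF P \<theta>] by (auto intro!: derivative_eq_intros)
    moreover have "exp (- b * cgf1 P \<theta>) * (- b * cgf2 P \<theta>) + b * v = 0"
      unfolding var[OF \<theta>] by (simp add: exp_minus field_simps)
    ultimately show "((\<lambda>\<theta>. exp (- b * cgf1 P \<theta>) + b * v * \<theta>) has_real_derivative 0) (at \<theta> within interior (cgf_dom P))"
      by (metis has_field_derivative_at_within)
  qed
  then obtain C where C: "\<And>\<theta>. \<theta> \<in> interior (cgf_dom P) \<Longrightarrow> exp (- b * cgf1 P \<theta>) + b * v * \<theta> = C" by blast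
  \<comment> \<open>The zero of the affine function that \<open>exp (- b * cgf1 P \<theta>)\<close>
    has turned out to be.\<close>
  define \<theta>\<^sub>0 where "\<theta>\<^sub>0 = C / (b * v)"
  have U: "b * v * (\<theta>\<^sub>0 - \<theta>) = exp (- b * cgf1 P \<theta>)" if "\<theta> \<in> interior (cgf_dom P)" for \<theta>
    using C[OF that] v b by (simp add: \<theta>\<^sub>0_def algebra_simps)
  have bvb: "b * v * b > 0"
    using mult_pos_pos[OF v, of "b * b"] not_square_less_zero[of b] b by (simp add: mult_ac less_le)
  have "full_log_mean_family P (b * v) b \<theta>\<^sub>0"
  proof (intro full_log_mean_family.intro log_mean_family.intro P(1))
    show "log_mean_family_axioms P (b * v) b \<theta>\<^sub>0"
      by unfold_locales (use P ne bvb b U in auto)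
    show "full_log_mean_family_axioms P"
      by unfold_locales (rule means)
  qed
  then show ?thesis by (rule that)
qed

section \<open>Exponential families of Levy processes\<close>

lemma exp_family_levyE:
  assumes "exp_family_levy \<Omega>' M X"
  obtains P where "prob_space P" "sets P = sets borel" "interior (cgf_dom P) \<noteq> {}"
    "\<Omega>' = mean_map P ` cgf_dom P"
    "\<And>\<theta>. \<theta> \<in> cgf_dom P \<Longrightarrow> levy_process (M (mean_map P \<theta>)) (X (mean_map P \<theta>))"
    "\<And>\<theta>. \<theta> \<in> cgf_dom P \<Longrightarrow> distr (M (mean_map P \<theta>)) borel (X (mean_map P \<theta>) 1) = tilt P \<theta>"
  using assms unfolding exp_family_levy_def tilt_def by blast

locale levy_exp_family = prob_space P for P :: "real measure" +
  fixes M :: "ereal \<Rightarrow> 'w measure" and X :: "ereal \<Rightarrow> real \<Rightarrow> 'w \<Rightarrow> real"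
  assumes sets_P: "sets P = sets borel"
    and int_nonempty: "interior (cgf_dom P) \<noteq> {}"
    and levy: "\<And>\<theta>. \<theta> \<in> cgf_dom P \<Longrightarrow> levy_process (M (mean_map P \<theta>)) (X (mean_map P \<theta>))"
    and law: "\<And>\<theta>. \<theta> \<in> cgf_dom P \<Longrightarrow>
      distr (M (mean_map P \<theta>)) borel (X (mean_map P \<theta>) 1) = tilt P \<theta>"
begin

lemma P: "prob_space P" "sets P = sets borel"
  by (rule prob_space_axioms) (rule sets_P)

lemma int_dom: "\<theta> \<in> interior (cgf_dom P) \<Longrightarrow> \<theta> \<in> cgf_dom P"
  using interior_subset by blast

definition marginal :: "real \<Rightarrow> real \<Rightarrow> real measure" where
  "marginal \<theta> t = distr (M (mean_map P \<theta>)) borel (X (mean_map P \<theta>) t)"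

lemma sets_marginal [simp]: "sets (marginal \<theta> t) = sets borel"
  by (simp add: marginal_def)

lemma prob_space_marginal:
  assumes "\<theta> \<in> cgf_dom P" "t \<ge> 0"
  shows "prob_space (marginal \<theta> t)"
  unfolding marginal_def using levy_process_marginal[OF levy] assms by blast

lemma marginal_cgf_dom:
  assumes "\<theta> \<in> cgf_dom P" "t > 0"
  shows "s \<in> cgf_dom (marginal \<theta> t) \<longleftrightarrow> \<theta> + s \<in> cgf_dom P"
  unfolding marginal_def using assms by (intro levy_tilted_cgf_dom[OF levy[OF assms(1)] P assms(1) law[OF assms(1)]])

lemma marginal_cgf:
  assumes "\<theta> \<in> cgf_dom P" "t > 0" "\<theta> + s \<in> cgf_dom P"
  shows "cgf (marginal \<theta> t) s = t * (cgf P (\<theta> + s) - cgf P \<theta>)"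
  unfolding marginal_def using assms by (intro levy_tilted_cgf[OF levy[OF assms(1)] P assms(1) law[OF assms(1)]])

text \<open>One computation for two uses: the dispersion model (\<open>c = 1 / t\<close>,
  \<open>d = 0\<close>) and the right-hand side of self-similarity, where \<open>d\<close> is the
  drift.\<close>

lemma affine_marginal:
  assumes "\<theta> \<in> cgf_dom P" "t > 0"
  defines "Q \<equiv> \<lambda>c d. distr (marginal \<theta> t) borel (\<lambda>x. c * x + d)"
  shows "prob_space (Q c d)" "sets (Q c d) = sets borel"
    and "s \<in> cgf_dom (Q c d) \<longleftrightarrow> \<theta> + c * s \<in> cgf_dom P"
    and "\<theta> + c * s \<in> cgf_dom P \<Longrightarrow> cgf (Q c d) s = t * (cgf P (\<theta> + c * s) - cgf P \<theta>) + d * s"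
proof -
  note [measurable_cong] = sets_marginal
  have pm: "prob_space (marginal \<theta> t)" using assms by (intro prob_space_marginal) auto
  show "prob_space (Q c d)" unfolding Q_def by (rule prob_space.prob_space_distr[OF pm]) measurable
  show sets: "sets (Q c d) = sets borel" by (simp add: Q_def)
  have "(\<integral>\<^sup>+x. ennreal (exp (s * x)) \<partial>Q c d) = (\<integral>\<^sup>+x. ennreal (exp (d * s)) * ennreal (exp (c * s * x)) \<partial>marginal \<theta> t)"
    unfolding Q_def by (subst nn_integral_distr)
      (auto intro!: nn_integral_cong simp: ennreal_mult[symmetric] exp_add[symmetric] algebra_simps)
  also have "\<dots> = ennreal (exp (d * s)) * (\<integral>\<^sup>+x. ennreal (exp (c * s * x)) \<partial>marginal \<theta> t)"
    by (intro nn_integral_cmult) auto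
  finally have eq: "(\<integral>\<^sup>+x. ennreal (exp (s * x)) \<partial>Q c d) =
      ennreal (exp (d * s)) * (\<integral>\<^sup>+x. ennreal (exp (c * s * x)) \<partial>marginal \<theta> t)" .
  then show "s \<in> cgf_dom (Q c d) \<longleftrightarrow> \<theta> + c * s \<in> cgf_dom P"
    using marginal_cgf_dom[OF assms(1,2), of "c * s"]
    by (auto simp: cgf_dom_nn[OF sets] cgf_dom_nn[OF sets_marginal] ennreal_mult_less_top)
  assume s: "\<theta> + c * s \<in> cgf_dom P"
  show "cgf (Q c d) s = t * (cgf P (\<theta> + c * s) - cgf P \<theta>) + d * s"
  proof (rule cgf_eqI(2)[OF sets])
    have "c * s \<in> cgf_dom (marginal \<theta> t)" using s marginal_cgf_dom[OF assms(1,2)] by simp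
    from nn_integral_exp_cgf[OF pm this]
    show "(\<integral>\<^sup>+x. ennreal (exp (s * x)) \<partial>Q c d) = ennreal (exp (t * (cgf P (\<theta> + c * s) - cgf P \<theta>) + d * s))"
      unfolding eq by (simp add: marginal_cgf[OF assms(1,2) s] ennreal_mult[symmetric] exp_add[symmetric] add.commute)
  qed
qed

text \<open>The set on which cumulant generating functions are compared. It contains 0 only if
  \<theta> is an interior point.\<close>

lemma dom_affine_open:
  assumes "\<theta> \<in> cgf_dom P" "c > 0"
  shows "open {s. \<theta> + c * s \<in> interior (cgf_dom P)}" "{s. \<theta> + c * s \<in> interior (cgf_dom P)} \<noteq> {}"
proof -
  show "open {s. \<theta> + c * s \<in> interior (cgf_dom P)}"
  proof -
    have "continuous_on UNIV (\<lambda>s. \<theta> + c * s)" by (intro continuous_intros)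
    from open_vimage[OF open_interior this] show ?thesis by (simp add: vimage_def)
  qed
  obtain \<eta> where "\<eta> \<in> interior (cgf_dom P)" using int_nonempty by blast
  then have "\<theta> + c * ((\<eta> - \<theta>) / c) \<in> interior (cgf_dom P)" using \<open>c > 0\<close> by simp
  then show "{s. \<theta> + c * s \<in> interior (cgf_dom P)} \<noteq> {}" by blast
qed

section \<open>The dispersion model of a Levy family and its moments\<close>

definition dispersion_model :: "ereal \<Rightarrow> real \<Rightarrow> real measure" where
  "dispersion_model \<mu> t = distr (M \<mu>) borel (\<lambda>\<omega>. X \<mu> t \<omega> / t)"

lemma dispersion_model_marginal:
  assumes "\<theta> \<in> cgf_dom P" "t > 0"
  shows "dispersion_model (mean_map P \<theta>) t = distr (marginal \<theta> t) borel (\<lambda>x. (1 / t) * x + 0)"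
  unfolding dispersion_model_def marginal_def
  using levy_process_measurable[OF levy[OF assms(1)], of t] assms(2)
  by (subst distr_distr) (auto simp: comp_def)

text \<open>The generating measures are the laws of \<open>X t / t\<close> for the member at
  parameter 0, whose time-one law is \<open>P\<close> itself. At index \<open>t\<close>, every other
  member is the tilt of that law at \<open>t * \<theta>\<close>, by comparison of cumulant
  generating functions.\<close>

lemma inf_div_edm_dispersion_model: "inf_div_edm P dispersion_model"
  unfolding inf_div_edm_def
proof (intro conjI P int_nonempty exI allI impI)
  let ?\<nu> = "\<lambda>t. dispersion_model (mean_map P 0) t"
  fix t :: real assume t: "t > 0"
  note 0 = zero_in_cgf_dom[OF P]
  note \<nu> = affine_marginal[where c = "1 / t" and d = 0, OF 0(1) t, folded dispersion_model_marginal[OF 0(1) t]]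
  show "prob_space (?\<nu> t)" "sets (?\<nu> t) = sets borel" using \<nu>(1,2) .
  show "cgf_dom (?\<nu> t) = (\<lambda>\<theta>. t * \<theta>) ` cgf_dom P"
  proof (intro set_eqI iffI)
    fix s assume "s \<in> cgf_dom (?\<nu> t)"
    then have "s / t \<in> cgf_dom P" using \<nu>(3) by simp
    moreover have "s = t * (s / t)" using t by simp
    ultimately show "s \<in> (\<lambda>\<theta>. t * \<theta>) ` cgf_dom P" by (rule rev_image_eqI)
  next
    fix s assume "s \<in> (\<lambda>\<theta>. t * \<theta>) ` cgf_dom P"
    then obtain \<theta> where "\<theta> \<in> cgf_dom P" "s = t * \<theta>" by blast
    then show "s \<in> cgf_dom (?\<nu> t)" using \<nu>(3)[of s] t by simp
  qed
  show "\<forall>\<theta>\<in>cgf_dom P. cgf (?\<nu> t) (t * \<theta>) = t * cgf P \<theta> \<and>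
      dispersion_model (mean_map P \<theta>) t = density (?\<nu> t) (\<lambda>y. ennreal (exp (t * (\<theta> * y - cgf P \<theta>))))"
  proof (intro ballI conjI)
    fix \<theta> assume \<theta>: "\<theta> \<in> cgf_dom P"
    show cgf\<nu>: "cgf (?\<nu> t) (t * \<theta>) = t * cgf P \<theta>"
      using \<nu>(4)[of "t * \<theta>"] \<theta> t 0 by simp
    have dom\<nu>: "s \<in> cgf_dom (?\<nu> t) \<longleftrightarrow> s / t \<in> cgf_dom P" for s using \<nu>(3)[of s] by simp
    note D = affine_marginal[where c = "1 / t" and d = 0, OF \<theta> t, folded dispersion_model_marginal[OF \<theta> t]]
    have "dispersion_model (mean_map P \<theta>) t = tilt (?\<nu> t) (t * \<theta>)"
    proof (rule real_distribution_eqI_cgf)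
      show "prob_space (dispersion_model (mean_map P \<theta>) t)"
        "sets (dispersion_model (mean_map P \<theta>) t) = sets borel" using D(1,2) .
      show "prob_space (tilt (?\<nu> t) (t * \<theta>))"
        by (rule prob_space_tilt[OF \<nu>(1,2)]) (use \<theta> t in \<open>simp add: dom\<nu>\<close>)
      show "sets (tilt (?\<nu> t) (t * \<theta>)) = sets borel" using \<nu>(2) by simp
      show "open {s. \<theta> + 1 / t * s \<in> interior (cgf_dom P)}" "{s. \<theta> + 1 / t * s \<in> interior (cgf_dom P)} \<noteq> {}"
        using dom_affine_open[OF \<theta>, of "1 / t"] t by auto
      fix s assume "s \<in> {s. \<theta> + 1 / t * s \<in> interior (cgf_dom P)}"
      then have s: "\<theta> + 1 / t * s \<in> cgf_dom P" using int_dom by blast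
      have eq: "(t * \<theta> + s) / t = \<theta> + 1 / t * s" using t by (simp add: add_divide_distrib)
      then have s': "t * \<theta> + s \<in> cgf_dom (?\<nu> t)" using s by (simp add: dom\<nu>)
      have "cgf (tilt (?\<nu> t) (t * \<theta>)) s = t * cgf P (\<theta> + 1 / t * s) - t * cgf P \<theta>"
        using cgf_tilt[OF \<nu>(1,2) s'] \<nu>(4)[of "t * \<theta> + s"] s 0 eq cgf\<nu> by simp
      then show "s \<in> cgf_dom (dispersion_model (mean_map P \<theta>) t) \<and> s \<in> cgf_dom (tilt (?\<nu> t) (t * \<theta>)) \<and>
          cgf (dispersion_model (mean_map P \<theta>) t) s = cgf (tilt (?\<nu> t) (t * \<theta>)) s"
        using D(3)[of s] D(4)[of s] s s' cgf_dom_tilt[OF \<nu>(2)] by (simp add: right_diff_distrib)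
    qed
    then show "dispersion_model (mean_map P \<theta>) t = density (?\<nu> t) (\<lambda>y. ennreal (exp (t * (\<theta> * y - cgf P \<theta>))))"
      unfolding tilt_def cgf\<nu> by (simp add: right_diff_distrib mult.assoc)
  qed
qed

lemma dispersion_model_moments:
  assumes "\<theta> \<in> interior (cgf_dom P)" "t > 0"
  defines "D \<equiv> dispersion_model (mean_map P \<theta>) t"
  shows "(\<integral>y. y \<partial>D) = cgf1 P \<theta>" "(\<integral>y. (y - (\<integral>y. y \<partial>D))\<^sup>2 \<partial>D) = cgf2 P \<theta> / t"
proof -
  note \<theta> = int_dom[OF assms(1)]
  note D = affine_marginal[where c = "1 / t" and d = 0, OF \<theta> assms(2), folded dispersion_model_marginal[OF \<theta> assms(2)], folded D_def]
  show "(\<integral>y. y \<partial>D) = cgf1 P \<theta>" "(\<integral>y. (y - (\<integral>y. y \<partial>D))\<^sup>2 \<partial>D) = cgf2 P \<theta> / t"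
    by (rule scaled_cgf_moments[OF P assms(1,2) D(1,2)]; use D(3,4) in simp)+
qed

lemma variance_function_interior:
  assumes "\<theta> \<in> interior (cgf_dom P)"
  shows "mean_map P \<theta> = ereal (cgf1 P \<theta>)" "variance_function M X (cgf1 P \<theta>) = cgf2 P \<theta>"
proof -
  note \<theta> = int_dom[OF assms]
  show m: "mean_map P \<theta> = ereal (cgf1 P \<theta>)"
    using assms by (simp add: mean_map_def deriv_cgf[OF P])
  have [measurable]: "X (mean_map P \<theta>) 1 \<in> borel_measurable (M (mean_map P \<theta>))"
    by (rule levy_process_measurable[OF levy[OF \<theta>]]) simp
  have "(\<integral>x. (x - (\<integral>x. x \<partial>tilt P \<theta>))\<^sup>2 \<partial>tilt P \<theta>) = variance_function M X (cgf1 P \<theta>)"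
    unfolding law[OF \<theta>, symmetric] variance_function_def m[symmetric]
    by (simp add: integral_distr)
  then show "variance_function M X (cgf1 P \<theta>) = cgf2 P \<theta>"
    using tilt_moments[OF P assms] by simp
qed

text \<open>The family's own dispersion model serves as the Tweedie model, so what remains is its
  index set and its first two moments.\<close>

lemma hougaard_of_variance:
  assumes v: "v > 0" and b: "b \<noteq> 0"
    and \<Omega>: "\<Omega>' = mean_map P ` cgf_dom P" and real: "\<And>y. ereal y \<in> \<Omega>'"
    and V: "\<And>\<mu>. variance_function M X \<mu> = v * exp (b * \<mu>)"
  shows "hougaard_infinity_family v b \<Omega>' M X"
    and "\<exists>\<theta>\<^sub>0. full_log_mean_family P (b * v) b \<theta>\<^sub>0"
proof -
  have means: "\<exists>\<theta>\<in>cgf_dom P. mean_map P \<theta> = ereal y" for y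
    using real[of y] unfolding \<Omega> by (metis imageE)
  obtain \<theta>\<^sub>0 where full: "full_log_mean_family P (b * v) b \<theta>\<^sub>0"
    by (rule full_log_mean_familyI[OF P int_nonempty v b _ means])
      (metis V variance_function_interior(2))
  then show "\<exists>\<theta>\<^sub>0. full_log_mean_family P (b * v) b \<theta>\<^sub>0" by blast
  interpret full: full_log_mean_family P "b * v" b \<theta>\<^sub>0 by (rule full)
  show "hougaard_infinity_family v b \<Omega>' M X"
    unfolding hougaard_infinity_family_def tweedie_infinity_def
  proof (intro conjI exI ballI allI impI)
    show "\<Omega>' = hougaard_index_set b" using \<Omega> full.mean_map_image by simp
    show "inf_div_edm P dispersion_model" by (rule inf_div_edm_dispersion_model)
    show "mean_map P ` cgf_dom P = hougaard_index_set b" by (rule full.mean_map_image)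
  next
    fix \<mu> t :: real assume t: "t > 0"
    \<comment> \<open>The parameter with mean \<open>\<mu>\<close>, found by solving
      \<open>U \<theta> = exp (- b * \<mu>)\<close>.\<close>
    define \<theta> where "\<theta> = \<theta>\<^sub>0 - exp (- b * \<mu>) / (b * v)"
    have U: "b * v * (\<theta>\<^sub>0 - \<theta>) = exp (- b * \<mu>)" unfolding \<theta>_def by (rule full.U_inverse)
    then have \<theta>: "\<theta> \<in> interior (cgf_dom P)" by (simp add: full.interior_eq)
    have m: "cgf1 P \<theta> = \<mu>" using full.cgf1_eq[OF \<theta>] U b by simp
    then have "mean_map P \<theta> = ereal \<mu>" "cgf2 P \<theta> = v * exp (b * \<mu>)"
      using variance_function_interior[OF \<theta>] V by auto
    with dispersion_model_moments[OF \<theta> t] m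
    show "prob_space.expectation (dispersion_model (ereal \<mu>) t) (\<lambda>y. y) = \<mu>"
      "prob_space.variance (dispersion_model (ereal \<mu>) t) (\<lambda>y. y) = v * exp (b * \<mu>) / t"
      by auto
  next
    fix \<mu> assume "\<mu> \<in> \<Omega>'"
    then obtain \<theta> where \<theta>: "\<theta> \<in> cgf_dom P" "\<mu> = mean_map P \<theta>" using \<Omega> by blast
    then show L: "levy_process (M \<mu>) (X \<mu>)" using levy by simp
    fix t :: real assume "t > 0"
    then have "(\<lambda>y. t * y) \<circ> (\<lambda>\<omega>. X \<mu> t \<omega> / t) = X \<mu> t" by auto
    then show "distr (M \<mu>) borel (X \<mu> t) = distr (dispersion_model \<mu> t) borel (\<lambda>y. t * y)"
      unfolding dispersion_model_def using levy_process_measurable[OF L, of t] \<open>t > 0\<close>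
      by (subst distr_distr) auto
  qed
qed

end

lemma variance_of_hougaard:
  assumes "hougaard_infinity_family v b \<Omega>' M X" "b \<noteq> 0"
  shows "ereal \<mu> \<in> \<Omega>'" "variance_function M X \<mu> = v * exp (b * \<mu>)"
proof -
  obtain D where \<Omega>: "\<Omega>' = hougaard_index_set b" and T: "tweedie_infinity v b D"
    and XD: "\<forall>\<mu>\<in>\<Omega>'. levy_process (M \<mu>) (X \<mu>) \<and>
      (\<forall>t>0. distr (M \<mu>) borel (X \<mu> t) = distr (D \<mu> t) borel (\<lambda>y. t * y))"
    using assms(1) unfolding hougaard_infinity_family_def by (elim conjE exE) (rule that)
  have X: "levy_process (M \<mu>) (X \<mu>)" if "\<mu> \<in> \<Omega>'" for \<mu> using XD that by simp
  have law: "distr (M \<mu>) borel (X \<mu> t) = distr (D \<mu> t) borel (\<lambda>y. t * y)"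
    if "\<mu> \<in> \<Omega>'" "t > 0" for \<mu> t using XD that by simp
  obtain P where D: "inf_div_edm P D" "mean_map P ` cgf_dom P = hougaard_index_set b"
    using T unfolding tweedie_infinity_def by (elim conjE exE) (rule that)
  have var: "(\<integral>y. (y - (\<integral>y. y \<partial>D (ereal \<mu>) t))\<^sup>2 \<partial>D (ereal \<mu>) t) = v * exp (b * \<mu>) / t" if "t > 0" for t
    using T that unfolding tweedie_infinity_def by blast
  show \<mu>: "ereal \<mu> \<in> \<Omega>'" by (simp add: \<Omega> hougaard_index_set_def)
  then obtain \<theta> where \<theta>: "\<theta> \<in> cgf_dom P" "mean_map P \<theta> = ereal \<mu>"
    using D(2) \<Omega> by (metis imageE)
  obtain \<nu> where "\<forall>t>0. prob_space (\<nu> t) \<and> sets (\<nu> t) = sets borel \<and>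
      cgf_dom (\<nu> t) = (\<lambda>\<theta>. t * \<theta>) ` cgf_dom P \<and>
      (\<forall>\<theta>\<in>cgf_dom P. cgf (\<nu> t) (t * \<theta>) = t * cgf P \<theta> \<and>
        D (mean_map P \<theta>) t = density (\<nu> t) (\<lambda>y. ennreal (exp (t * (\<theta> * y - cgf P \<theta>)))))"
    using D(1) unfolding inf_div_edm_def by (elim conjE exE) (rule that)
  from this[rule_format, of 1] \<theta>
  have "sets (\<nu> 1) = sets borel" "D (ereal \<mu>) 1 = density (\<nu> 1) (\<lambda>y. ennreal (exp (1 * (\<theta> * y - cgf P \<theta>))))"
    by auto
  \<comment> \<open>The sigma-algebra of \<open>D\<close> is known only through its representation
    as a density; it is needed to identify \<open>D\<close> at index 1 with the time-one law of the
    process.\<close>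
  then have sets_D [measurable_cong]: "sets (D (ereal \<mu>) 1) = sets borel" by simp
  have "distr (D (ereal \<mu>) 1) borel (\<lambda>y. 1 * y) = D (ereal \<mu>) 1"
    by (simp add: distr_id2 sets_D)
  then have eq: "D (ereal \<mu>) 1 = distr (M (ereal \<mu>)) borel (X (ereal \<mu>) 1)"
    using law[OF \<mu>, of 1] by simp
  have [measurable]: "X (ereal \<mu>) 1 \<in> borel_measurable (M (ereal \<mu>))"
    using levy_process_measurable[OF X[OF \<mu>]] by simp
  show "variance_function M X \<mu> = v * exp (b * \<mu>)"
    using var[of 1] unfolding eq variance_function_def by (simp add: integral_distr)
qed

section \<open>Self-similarity\<close>

text \<open>The map \<open>x \<mapsto> \<theta> + c * (x - \<theta>')\<close> is a homeomorphism of
  the line under which \<open>D\<close> is its own preimage.\<close>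

lemma interior_affine_transfer:
  fixes D :: "real set"
  assumes "c > 0" and dom: "\<And>s. \<theta>' + s \<in> D \<longleftrightarrow> \<theta> + c * s \<in> D"
  shows "\<theta>' + s \<in> interior D \<longleftrightarrow> \<theta> + c * s \<in> interior D"
proof
  have "continuous_on UNIV (\<lambda>x. \<theta> + c * (x - \<theta>'))" by (intro continuous_intros)
  from open_vimage[OF open_interior this]
  have o: "open {x. \<theta> + c * (x - \<theta>') \<in> interior D}" by (simp add: vimage_def)
  assume *: "\<theta> + c * s \<in> interior D"
  show "\<theta>' + s \<in> interior D"
  proof (rule interiorI[OF o])
    show "{x. \<theta> + c * (x - \<theta>') \<in> interior D} \<subseteq> D"
    proof
      fix x assume "x \<in> {x. \<theta> + c * (x - \<theta>') \<in> interior D}"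
      then have "\<theta> + c * (x - \<theta>') \<in> D" using interior_subset by blast
      then show "x \<in> D" using dom[of "x - \<theta>'"] by simp
    qed
  qed (use * in simp)
next
  have "continuous_on UNIV (\<lambda>x. \<theta>' + (x - \<theta>) / c)" using \<open>c > 0\<close> by (intro continuous_intros) auto
  from open_vimage[OF open_interior this]
  have o: "open {x. \<theta>' + (x - \<theta>) / c \<in> interior D}" by (simp add: vimage_def)
  assume *: "\<theta>' + s \<in> interior D"
  show "\<theta> + c * s \<in> interior D"
  proof (rule interiorI[OF o])
    show "{x. \<theta>' + (x - \<theta>) / c \<in> interior D} \<subseteq> D"
    proof
      fix x assume "x \<in> {x. \<theta>' + (x - \<theta>) / c \<in> interior D}"
      then have "\<theta>' + (x - \<theta>) / c \<in> D" using interior_subset by blast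
      then show "x \<in> D" using dom[of "(x - \<theta>) / c"] \<open>c > 0\<close> by simp
    qed
  qed (use * \<open>c > 0\<close> in simp)
qed

text \<open>For \<open>c = 2\<close> the affine map has a fixed point \<open>x\<^sub>0\<close>, and \<open>g x\<^sub>0 = 2 g x\<^sub>0\<close> excludes it from \<open>I\<close>.
  As \<open>I\<close> is invariant under dilations about \<open>x\<^sub>0\<close>, it is an open half-line ending at \<open>x\<^sub>0\<close>; then
  the maps for all other \<open>c\<close> must fix \<open>x\<^sub>0\<close> as well.\<close>

lemma affine_self_similar_half_line:
  fixes g :: "real \<Rightarrow> real"
  assumes "I \<noteq> {}" and conv: "\<And>x y z. x \<in> I \<Longrightarrow> z \<in> I \<Longrightarrow> x \<le> y \<Longrightarrow> y \<le> z \<Longrightarrow> y \<in> I"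
    and pos: "\<And>x. x \<in> I \<Longrightarrow> g x > 0"
    and self: "\<And>\<theta> c. \<theta> \<in> I \<Longrightarrow> c > 0 \<Longrightarrow>
      \<exists>\<theta>'. \<forall>s. (\<theta>' + s \<in> I \<longleftrightarrow> \<theta> + c * s \<in> I) \<and> (\<theta> + c * s \<in> I \<longrightarrow> g (\<theta>' + s) = c * g (\<theta> + c * s))"
  obtains x\<^sub>0 \<epsilon> k where "\<epsilon> = 1 \<or> \<epsilon> = - 1" "k > 0" "I = {x. \<epsilon> * (x\<^sub>0 - x) > 0}"
    "\<And>x. x \<in> I \<Longrightarrow> g x = k / (\<epsilon> * (x\<^sub>0 - x))"
proof -
  obtain \<theta> where \<theta>: "\<theta> \<in> I" using \<open>I \<noteq> {}\<close> by blast
  obtain \<theta>' where \<theta>': "\<And>s. \<theta>' + s \<in> I \<longleftrightarrow> \<theta> + 2 * s \<in> I"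
    "\<And>s. \<theta> + 2 * s \<in> I \<Longrightarrow> g (\<theta>' + s) = 2 * g (\<theta> + 2 * s)"
    using self[OF \<theta>, of 2] by auto
  \<comment> \<open>The fixed point: \<open>\<theta>' + s = \<theta> + 2 * s\<close> holds for
    \<open>s = \<theta>' - \<theta>\<close>.\<close>
  define x\<^sub>0 where "x\<^sub>0 = 2 * \<theta>' - \<theta>"
  have x0: "x\<^sub>0 \<notin> I"
  proof
    assume "x\<^sub>0 \<in> I"
    moreover have "\<theta> + 2 * (\<theta>' - \<theta>) = x\<^sub>0" "\<theta>' + (\<theta>' - \<theta>) = x\<^sub>0" by (auto simp: x\<^sub>0_def)
    ultimately have "g x\<^sub>0 = 2 * g x\<^sub>0" using \<theta>'(2)[of "\<theta>' - \<theta>"] by simp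
    then show False using pos[OF \<open>x\<^sub>0 \<in> I\<close>] by simp
  qed
  define \<epsilon> :: real where "\<epsilon> = (if x\<^sub>0 > \<theta> then 1 else - 1)"
  have \<epsilon>: "\<epsilon> = 1 \<or> \<epsilon> = - 1" by (simp add: \<epsilon>_def)
  then have \<epsilon>2: "\<epsilon> * (\<epsilon> * x) = x" for x by auto
  define r\<^sub>0 where "r\<^sub>0 = \<epsilon> * (x\<^sub>0 - \<theta>)"
  have "x\<^sub>0 \<noteq> \<theta>" using x0 \<theta> by blast
  then have r0: "r\<^sub>0 > 0" by (simp add: r\<^sub>0_def \<epsilon>_def)
  have coord: "x = x\<^sub>0 - \<epsilon> * (\<epsilon> * (x\<^sub>0 - x))" for x by (subst \<epsilon>2) simp
  \<comment> \<open>Signed distances from \<open>x\<^sub>0\<close>, oriented by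
    \<open>\<epsilon>\<close> so that the known point of \<open>I\<close> has positive distance;
    this treats both half-lines at once.\<close>
  define R where "R = {r. x\<^sub>0 - \<epsilon> * r \<in> I}"
  have I_R: "x \<in> I \<longleftrightarrow> \<epsilon> * (x\<^sub>0 - x) \<in> R" for x unfolding R_def using coord[of x] by simp
  have r0R: "r\<^sub>0 \<in> R" using \<theta> I_R by (simp add: r\<^sub>0_def)
  have R_conv: "r \<in> R" if "r1 \<in> R" "r2 \<in> R" "r1 \<le> r" "r \<le> r2" for r1 r r2
    using \<epsilon>
  proof
    assume "\<epsilon> = 1"
    then show ?thesis using conv[of "x\<^sub>0 - r2" "x\<^sub>0 - r1" "x\<^sub>0 - r"] that by (simp add: R_def)
  next
    assume "\<epsilon> = - 1"
    then show ?thesis using conv[of "x\<^sub>0 + r1" "x\<^sub>0 + r2" "x\<^sub>0 + r"] that by (simp add: R_def)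
  qed
  have R2: "r \<in> R \<longleftrightarrow> 2 * r \<in> R" for r
  proof -
    have e: "\<theta>' + (x\<^sub>0 - \<epsilon> * r - \<theta>') = x\<^sub>0 - \<epsilon> * r" "\<theta> + 2 * (x\<^sub>0 - \<epsilon> * r - \<theta>') = x\<^sub>0 - \<epsilon> * (2 * r)"
      by (simp_all add: x\<^sub>0_def algebra_simps)
    show ?thesis using \<theta>'(1)[of "x\<^sub>0 - \<epsilon> * r - \<theta>'"] unfolding R_def mem_Collect_eq e .
  qed
  have "R = {0<..}"
  proof (intro set_eqI iffI)
    fix r assume "r \<in> R"
    show "r \<in> {0<..}"
    proof (rule ccontr)
      assume "r \<notin> {0<..}"
      then have "0 \<in> R" using R_conv[OF \<open>r \<in> R\<close> r0R] r0 by simp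
      then show False using x0 by (simp add: R_def)
    qed
  next
    fix r :: real assume "r \<in> {0<..}"
    then have r: "r > 0" by simp
    \<comment> \<open>Doubling and halving \<open>r\<^sub>0\<close> reaches arbitrarily large and
      arbitrarily small distances; convexity fills the gaps.\<close>
    have up: "2 ^ n * r\<^sub>0 \<in> R" for n
      by (induction n) (use r0R R2 in \<open>auto simp: mult.assoc\<close>)
    have down: "r\<^sub>0 / 2 ^ n \<in> R" for n
    proof (induction n)
      case (Suc n)
      then show ?case using R2[of "r\<^sub>0 / 2 ^ Suc n"] by simp
    qed (use r0R in simp)
    obtain n where n: "r / r\<^sub>0 < 2 ^ n" using real_arch_pow[of 2 "r / r\<^sub>0"] by auto
    obtain m where m: "r\<^sub>0 / r < 2 ^ m" using real_arch_pow[of 2 "r\<^sub>0 / r"] by auto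
    show "r \<in> R"
    proof (rule R_conv[OF down[of m] up[of n]])
      show "r\<^sub>0 / 2 ^ m \<le> r" using m r by (simp add: field_simps)
      show "r \<le> 2 ^ n * r\<^sub>0" using n r0 by (simp add: field_simps)
    qed
  qed
  then have I_eq: "x \<in> I \<longleftrightarrow> \<epsilon> * (x\<^sub>0 - x) > 0" for x by (simp add: I_R)
  define k where "k = g (x\<^sub>0 - \<epsilon>)"
  have "\<epsilon> * (x\<^sub>0 - (x\<^sub>0 - \<epsilon>)) > 0" using \<epsilon> by auto
  then have one: "x\<^sub>0 - \<epsilon> \<in> I" using I_eq by blast
  show ?thesis
  proof (rule that[OF \<epsilon>, of k x\<^sub>0])
    show "k > 0" using pos[OF one] by (simp add: k_def)
    show "I = {x. \<epsilon> * (x\<^sub>0 - x) > 0}" using I_eq by blast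
    fix x assume x: "x \<in> I"
    define r where "r = \<epsilon> * (x\<^sub>0 - x)"
    have r: "r > 0" using x I_eq by (simp add: r_def)
    \<comment> \<open>Starting at unit distance with factor \<open>1 / r\<close>, the new base point
      should have distance \<open>r\<close>, that is, be \<open>x\<close> itself; then
      \<open>s = 0\<close> gives the value of \<open>g\<close>.\<close>
    obtain \<eta> where \<eta>: "\<And>s. \<eta> + s \<in> I \<longleftrightarrow> x\<^sub>0 - \<epsilon> + (1 / r) * s \<in> I"
      "\<And>s. x\<^sub>0 - \<epsilon> + (1 / r) * s \<in> I \<Longrightarrow> g (\<eta> + s) = (1 / r) * g (x\<^sub>0 - \<epsilon> + (1 / r) * s)"
      using self[OF one, of "1 / r"] r by auto
    \<comment> \<open>Domain membership at \<open>s = \<epsilon> * u\<close> compares the endpoints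
      of the two half-lines; two numbers with the same strict lower bounds are equal.\<close>
    have iff: "\<epsilon> * (x\<^sub>0 - \<eta>) > u \<longleftrightarrow> r > u" for u
    proof -
      have e: "\<epsilon> * (x\<^sub>0 - (\<eta> + \<epsilon> * u)) = \<epsilon> * (x\<^sub>0 - \<eta>) - u"
        "\<epsilon> * (x\<^sub>0 - (x\<^sub>0 - \<epsilon> + (1 / r) * (\<epsilon> * u))) = 1 - u / r"
        using \<epsilon> by (auto simp: algebra_simps)
      have "0 < \<epsilon> * (x\<^sub>0 - \<eta>) - u \<longleftrightarrow> 0 < 1 - u / r"
        using \<eta>(1)[of "\<epsilon> * u"] unfolding I_eq e .
      then show ?thesis using r by simp
    qed
    have "\<epsilon> * (x\<^sub>0 - \<eta>) = r" using iff[of r] iff[of "\<epsilon> * (x\<^sub>0 - \<eta>)"] by linarith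
    moreover have "\<epsilon> \<noteq> 0" using \<epsilon> by auto
    ultimately have "\<eta> = x" by (simp add: r_def)
    then show "g x = k / (\<epsilon> * (x\<^sub>0 - x))"
      using \<eta>(2)[of 0] one by (simp add: k_def r_def)
  qed
qed

section \<open>Finite-dimensional laws in the extended reals\<close>

lemma fdd_eq_marginal:
  fixes Y :: "'t \<Rightarrow> 'v \<Rightarrow> 'b :: topological_space" and Z :: "'t \<Rightarrow> 'w \<Rightarrow> 'b"
  assumes "fdd_eq I M Y N Z" "t \<in> I"
    and [measurable]: "Y t \<in> borel_measurable M" "Z t \<in> borel_measurable N"
  shows "distr M borel (Y t) = distr N borel (Z t)"
proof -
  have "distr M (PiM {t} (\<lambda>_. borel)) (\<lambda>\<omega>. \<lambda>u\<in>{t}. Y u \<omega>) =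
      distr N (PiM {t} (\<lambda>_. borel)) (\<lambda>\<omega>. \<lambda>u\<in>{t}. Z u \<omega>)"
    using assms(1,2) unfolding fdd_eq_def by simp
  then have "distr (distr M (PiM {t} (\<lambda>_. borel)) (\<lambda>\<omega>. \<lambda>u\<in>{t}. Y u \<omega>)) borel (\<lambda>x. x t) =
      distr (distr N (PiM {t} (\<lambda>_. borel)) (\<lambda>\<omega>. \<lambda>u\<in>{t}. Z u \<omega>)) borel (\<lambda>x. x t)"
    by simp
  then show ?thesis
    by (subst (asm) (1 2) distr_distr) (auto simp: comp_def intro!: measurable_restrict)
qed

lemma fdd_eq_ereal:
  fixes Y :: "real \<Rightarrow> 'v \<Rightarrow> real" and Z :: "real \<Rightarrow> 'w \<Rightarrow> real"
  assumes meas: "\<And>t. t \<in> I \<Longrightarrow> Y t \<in> borel_measurable M" "\<And>t. t \<in> I \<Longrightarrow> Z t \<in> borel_measurable N"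
    and eq: "\<And>T. finite T \<Longrightarrow> T \<subseteq> I \<Longrightarrow>
      distr M (PiM T (\<lambda>_. borel)) (\<lambda>\<omega>. \<lambda>t\<in>T. Y t \<omega>) = distr N (PiM T (\<lambda>_. borel)) (\<lambda>\<omega>. \<lambda>t\<in>T. Z t \<omega>)"
  shows "fdd_eq I M (\<lambda>t \<omega>. ereal (Y t \<omega>)) N (\<lambda>t \<omega>. ereal (Z t \<omega>))"
  unfolding fdd_eq_def
proof (intro allI impI)
  fix T assume "finite T \<and> T \<subseteq> I"
  then have T: "finite T" "T \<subseteq> I" by auto
  let ?E = "\<lambda>x. \<lambda>t\<in>T. ereal (x t)"
  have E: "?E \<in> PiM T (\<lambda>_. borel) \<rightarrow>\<^sub>M PiM T (\<lambda>_. borel)"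
    by (intro measurable_restrict) measurable
  have push: "distr K (PiM T (\<lambda>_. borel)) (\<lambda>\<omega>. \<lambda>t\<in>T. ereal (W t \<omega>)) =
      distr (distr K (PiM T (\<lambda>_. borel)) (\<lambda>\<omega>. \<lambda>t\<in>T. W t \<omega>)) (PiM T (\<lambda>_. borel)) ?E"
    if "\<And>t. t \<in> I \<Longrightarrow> W t \<in> borel_measurable K" for K :: "'k measure" and W :: "real \<Rightarrow> 'k \<Rightarrow> real"
  proof -
    have "(\<lambda>\<omega>. \<lambda>t\<in>T. W t \<omega>) \<in> K \<rightarrow>\<^sub>M PiM T (\<lambda>_. borel)"
      using that T by (intro measurable_restrict) auto
    from distr_distr[OF E this] show ?thesis
      by (simp add: comp_def cong: restrict_cong)
  qed
  have "distr M (PiM T (\<lambda>_. borel)) (\<lambda>\<omega>. \<lambda>t\<in>T. ereal (Y t \<omega>)) =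
      distr (distr M (PiM T (\<lambda>_. borel)) (\<lambda>\<omega>. \<lambda>t\<in>T. Y t \<omega>)) (PiM T (\<lambda>_. borel)) ?E"
    by (rule push) (rule meas(1))
  also have "\<dots> = distr (distr N (PiM T (\<lambda>_. borel)) (\<lambda>\<omega>. \<lambda>t\<in>T. Z t \<omega>)) (PiM T (\<lambda>_. borel)) ?E"
    by (simp only: eq[OF T])
  also have "\<dots> = distr N (PiM T (\<lambda>_. borel)) (\<lambda>\<omega>. \<lambda>t\<in>T. ereal (Z t \<omega>))"
    by (rule push[symmetric]) (rule meas(2))
  finally show "distr M (PiM T (\<lambda>_. borel)) (\<lambda>\<omega>. \<lambda>t\<in>T. ereal (Y t \<omega>)) =
      distr N (PiM T (\<lambda>_. borel)) (\<lambda>\<omega>. \<lambda>t\<in>T. ereal (Z t \<omega>))" .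
qed

text \<open>The left-hand side is finite, whereas an infinite shift would make the right-hand side
  infinite everywhere. Hence the shift is real and both sides can be read as real laws.\<close>

lemma distr_ereal_eq_imp:
  fixes Y :: "'v \<Rightarrow> real" and Z :: "'w \<Rightarrow> real"
  assumes M: "prob_space M" "prob_space N" and [measurable]: "Y \<in> borel_measurable M" "Z \<in> borel_measurable N"
    and "c > 0" and eq: "distr M borel (\<lambda>\<omega>. ereal (Y \<omega>)) = distr N borel (\<lambda>\<omega>. ereal c * (ereal (Z \<omega>) + ereal 1 * f))"
  obtains r where "f = ereal r" "distr M borel Y = distr N borel (\<lambda>\<omega>. c * Z \<omega> + c * r)"
proof -
  have "\<bar>f\<bar> \<noteq> \<infinity>"
  proof
    assume f: "\<bar>f\<bar> = \<infinity>"
    have "AE x in distr M borel (\<lambda>\<omega>. ereal (Y \<omega>)). \<bar>x\<bar> \<noteq> \<infinity>"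
      by (subst AE_distr_iff) auto
    then have "AE \<omega> in N. \<bar>ereal c * (ereal (Z \<omega>) + ereal 1 * f)\<bar> \<noteq> \<infinity>"
      unfolding eq by (subst (asm) AE_distr_iff) auto
    then have "AE \<omega> in N. False"
    proof eventually_elim
      case (elim \<omega>)
      then show ?case using f \<open>c > 0\<close> by (cases f) auto
    qed
    then show False using prob_space.AE_False[OF M(2)] by blast
  qed
  then obtain r where r: "f = ereal r" by (cases f) auto
  have "distr (distr M borel (\<lambda>\<omega>. ereal (Y \<omega>))) borel real_of_ereal =
      distr (distr N borel (\<lambda>\<omega>. ereal (c * Z \<omega> + c * r))) borel real_of_ereal"
    using eq by (simp add: r distrib_left)
  then have "distr M borel Y = distr N borel (\<lambda>\<omega>. c * Z \<omega> + c * r)"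
    by (subst (asm) (1 2) distr_distr) (auto simp: comp_def)
  with r show ?thesis by (rule that)
qed

section \<open>Self-similar exponential families\<close>

context levy_exp_family
begin

text \<open>The parameter \<open>\<theta>'\<close> is one whose mean is the shifted mean. Equality
  of the time-one laws gives equal domains, and on interiors two differentiations turn the drift
  \<open>r * s\<close> first into the constant \<open>r\<close> and then into 0.\<close>

lemma self_similar_tilting:
  assumes ss: "self_similar_ext_1 (mean_map P ` cgf_dom P) M X"
    and \<theta>: "\<theta> \<in> interior (cgf_dom P)" and c: "c > 0"
  shows "\<exists>\<theta>'. \<forall>s. (\<theta>' + s \<in> interior (cgf_dom P) \<longleftrightarrow> \<theta> + c * s \<in> interior (cgf_dom P)) \<and>
    (\<theta> + c * s \<in> interior (cgf_dom P) \<longrightarrow> cgf2 P (\<theta>' + s) = c * cgf2 P (\<theta> + c * s))"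
proof -
  note \<theta>d = int_dom[OF \<theta>]
  obtain f where f: "mean_map P \<theta> + f \<in> mean_map P ` cgf_dom P"
    "fdd_eq {0<..} (M (mean_map P \<theta> + f)) (\<lambda>t \<omega>. ereal (X (mean_map P \<theta> + f) (c * t) \<omega>))
       (M (mean_map P \<theta>)) (\<lambda>t \<omega>. ereal c * (ereal (X (mean_map P \<theta>) t \<omega>) + ereal t * f))"
    using ss \<theta>d c unfolding self_similar_ext_1_def by blast
  obtain \<theta>' where \<theta>': "\<theta>' \<in> cgf_dom P" "mean_map P \<theta> + f = mean_map P \<theta>'"
    using f(1) by blast
  note L = levy[OF \<theta>d] and L' = levy[OF \<theta>'(1)]
  have m: "X (mean_map P \<theta>) 1 \<in> borel_measurable (M (mean_map P \<theta>))"
    "X (mean_map P \<theta>') (c * 1) \<in> borel_measurable (M (mean_map P \<theta>'))"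
    using levy_process_measurable[OF L] levy_process_measurable[OF L'] c by auto
  have "distr (M (mean_map P \<theta>')) borel (\<lambda>\<omega>. ereal (X (mean_map P \<theta>') (c * 1) \<omega>)) =
      distr (M (mean_map P \<theta>)) borel (\<lambda>\<omega>. ereal c * (ereal (X (mean_map P \<theta>) 1 \<omega>) + ereal 1 * f))"
    by (rule fdd_eq_marginal[OF f(2)[unfolded \<theta>'(2)], of 1]) (use m in measurable)
  then obtain r where r: "distr (M (mean_map P \<theta>')) borel (X (mean_map P \<theta>') (c * 1)) =
      distr (M (mean_map P \<theta>)) borel (\<lambda>\<omega>. c * X (mean_map P \<theta>) 1 \<omega> + c * r)"
    using distr_ereal_eq_imp[OF levy_process_prob_space[OF L'] levy_process_prob_space[OF L] m(2,1) c] by metis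
  have Q: "marginal \<theta>' c = distr (marginal \<theta> 1) borel (\<lambda>x. c * x + c * r)"
    unfolding marginal_def using r m by (subst distr_distr) (auto simp: comp_def)
  note A = affine_marginal[where c = c and d = "c * r" and t = 1, OF \<theta>d, folded Q]
  have dom: "\<theta>' + s \<in> cgf_dom P \<longleftrightarrow> \<theta> + c * s \<in> cgf_dom P" for s
    using A(3)[of s] marginal_cgf_dom[OF \<theta>'(1) c, of s] by simp
  note int = interior_affine_transfer[OF c dom]
  let ?S = "{s. \<theta> + c * s \<in> interior (cgf_dom P)}"
  note S = dom_affine_open(1)[OF \<theta>d c]
  have eq0: "cgf P (\<theta>' + s) = cgf P \<theta>' + (cgf P (\<theta> + c * s) - cgf P \<theta>) / c + r * s" if "s \<in> ?S" for s
  proof -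
    have s: "\<theta> + c * s \<in> cgf_dom P" using that int_dom by blast
    then have s': "\<theta>' + s \<in> cgf_dom P" using dom by blast
    have "c * (cgf P (\<theta>' + s) - cgf P \<theta>') = (cgf P (\<theta> + c * s) - cgf P \<theta>) + c * r * s"
      using A(4)[OF _ s] marginal_cgf[OF \<theta>'(1) c s'] by simp
    then show ?thesis using c by (simp add: field_simps)
  qed
  have shift: "((\<lambda>s. h (\<theta>' + s)) has_real_derivative h' (\<theta>' + s)) (at s)"
    "((\<lambda>s. h (\<theta> + c * s)) has_real_derivative c * h' (\<theta> + c * s)) (at s)"
    if "\<And>x. x \<in> interior (cgf_dom P) \<Longrightarrow> (h has_real_derivative h' x) (at x)" "s \<in> ?S" for h h' s
  proof -
    have i: "\<theta> + c * s \<in> interior (cgf_dom P)" "\<theta>' + s \<in> interior (cgf_dom P)"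
      using that(2) int by auto
    have "((\<lambda>s. h (\<theta>' + s)) has_real_derivative h' (\<theta>' + s) * 1) (at s)"
      by (rule DERIV_chain2[where f = h and g = "\<lambda>s. \<theta>' + s", OF that(1)[OF i(2)]]) (auto intro!: derivative_eq_intros)
    then show "((\<lambda>s. h (\<theta>' + s)) has_real_derivative h' (\<theta>' + s)) (at s)" by simp
    have "((\<lambda>s. h (\<theta> + c * s)) has_real_derivative h' (\<theta> + c * s) * c) (at s)"
      by (rule DERIV_chain2[where f = h and g = "\<lambda>s. \<theta> + c * s", OF that(1)[OF i(1)]]) (auto intro!: derivative_eq_intros)
    then show "((\<lambda>s. h (\<theta> + c * s)) has_real_derivative c * h' (\<theta> + c * s)) (at s)"
      by (simp add: mult.commute)
  qed
  have eq1: "cgf1 P (\<theta>' + s) = cgf1 P (\<theta> + c * s) + r" if s: "s \<in> ?S" for s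
  proof (rule DERIV_unique)
    note d = shift[of "cgf P", OF has_real_derivative_cgf[OF P] s]
    show "((\<lambda>s. cgf P (\<theta>' + s)) has_real_derivative cgf1 P (\<theta>' + s)) (at s)" by (rule d(1))
    have "((\<lambda>s. cgf P \<theta>' + (cgf P (\<theta> + c * s) - cgf P \<theta>) / c + r * s) has_real_derivative
        cgf1 P (\<theta> + c * s) + r) (at s)"
      using d(2) c by (auto intro!: derivative_eq_intros)
    then show "((\<lambda>s. cgf P (\<theta>' + s)) has_real_derivative cgf1 P (\<theta> + c * s) + r) (at s)"
      by (rule has_field_derivative_transform_within_open[OF _ S s]) (simp add: eq0)
  qed
  have eq2: "cgf2 P (\<theta>' + s) = c * cgf2 P (\<theta> + c * s)" if s: "s \<in> ?S" for s
  proof (rule DERIV_unique)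
    note d = shift[of "cgf1 P", OF has_real_derivative_cgf1[OF P] s]
    show "((\<lambda>s. cgf1 P (\<theta>' + s)) has_real_derivative cgf2 P (\<theta>' + s)) (at s)" by (rule d(1))
    have "((\<lambda>s. cgf1 P (\<theta> + c * s) + r) has_real_derivative c * cgf2 P (\<theta> + c * s)) (at s)"
      using d(2) by (auto intro!: derivative_eq_intros)
    then show "((\<lambda>s. cgf1 P (\<theta>' + s)) has_real_derivative c * cgf2 P (\<theta> + c * s)) (at s)"
      by (rule has_field_derivative_transform_within_open[OF _ S s]) (simp add: eq1)
  qed
  show ?thesis using int eq2 by blast
qed

text \<open>A zero of the variance at a single point would make \<open>P\<close> a point mass, whose
  mean map is constant.\<close>

lemma cgf2_pos:
  assumes two: "m \<in> mean_map P ` cgf_dom P" "m' \<in> mean_map P ` cgf_dom P" "m \<noteq> m'"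
    and \<theta>: "\<theta> \<in> interior (cgf_dom P)"
  shows "cgf2 P \<theta> > 0"
proof (rule ccontr)
  assume "\<not> cgf2 P \<theta> > 0"
  moreover have "cgf2 P \<theta> \<ge> 0"
    using tilt_moments(2)[OF P \<theta>] by (metis Bochner_Integration.integral_nonneg zero_le_power2)
  ultimately have "cgf2 P \<theta> = 0" by simp
  from cgf2_eq_0_imp_constant[OF P \<theta> this] obtain a where a: "AE x in P. x = a" by blast
  have nn: "(\<integral>\<^sup>+x. ennreal (exp (\<eta> * x)) \<partial>P) = ennreal (exp (\<eta> * a))" for \<eta>
  proof -
    have "(\<integral>\<^sup>+x. ennreal (exp (\<eta> * x)) \<partial>P) = (\<integral>\<^sup>+x. ennreal (exp (\<eta> * a)) \<partial>P)"
      using a by (intro nn_integral_cong_AE) auto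
    then show ?thesis by (simp add: emeasure_space_1)
  qed
  have dom: "cgf_dom P = UNIV" and cgf: "cgf P = (\<lambda>\<eta>. \<eta> * a)"
    using cgf_eqI[OF sets_P nn] by auto
  have "mean_map P \<eta> = ereal a" for \<eta>
    unfolding mean_map_def dom cgf by (auto intro!: DERIV_imp_deriv derivative_eq_intros)
  then show False using two by auto
qed

lemma self_similar_imp_variance:
  assumes ss: "self_similar_ext_1 (mean_map P ` cgf_dom P) M X"
    and two: "m \<in> mean_map P ` cgf_dom P" "m' \<in> mean_map P ` cgf_dom P" "m \<noteq> m'"
  obtains v b where "v > 0" "b \<noteq> 0" "\<And>y. ereal y \<in> mean_map P ` cgf_dom P"
    "\<And>y. variance_function M X y = v * exp (b * y)"
proof -
  let ?I = "interior (cgf_dom P)"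
  have ci: "convex ?I" using convex_cgf_dom[OF sets_P] by (rule convex_interior)
  obtain x\<^sub>0 \<epsilon> k where \<epsilon>: "\<epsilon> = 1 \<or> \<epsilon> = - 1" and k: "k > 0" and I: "?I = {x. \<epsilon> * (x\<^sub>0 - x) > 0}"
    and g: "\<And>x. x \<in> ?I \<Longrightarrow> cgf2 P x = k / (\<epsilon> * (x\<^sub>0 - x))"
  proof (rule affine_self_similar_half_line[of ?I "cgf2 P"])
    show "y \<in> ?I" if "x \<in> ?I" "z \<in> ?I" "x \<le> y" "y \<le> z" for x y z
      using ci that unfolding is_interval_convex_1[symmetric] is_interval_1 by blast
  qed (use int_nonempty cgf2_pos[OF two] self_similar_tilting[OF ss] in blast)+
  have \<epsilon>0: "\<epsilon> \<noteq> 0" using \<epsilon> by auto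
  \<comment> \<open>Integrates \<open>k / (\<epsilon> * (x\<^sub>0 - \<theta>))\<close>; the extra
    \<open>\<epsilon>\<close> compensates the slope \<open>- \<epsilon>\<close> of the distance, as
    \<open>\<epsilon> * \<epsilon> = 1\<close>.\<close>
  have "\<exists>C. \<forall>\<theta>\<in>?I. cgf1 P \<theta> + \<epsilon> * k * ln (\<epsilon> * (x\<^sub>0 - \<theta>)) = C"
  proof (rule has_field_derivative_zero_constant[OF ci])
    fix \<theta> assume \<theta>: "\<theta> \<in> ?I"
    then have pos: "\<epsilon> * (x\<^sub>0 - \<theta>) > 0" using I by blast
    have "((\<lambda>\<theta>. \<epsilon> * (x\<^sub>0 - \<theta>)) has_real_derivative - \<epsilon>) (at \<theta>)"
      by (auto intro!: derivative_eq_intros)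
    from DERIV_add[OF has_real_derivative_cgf1[OF P \<theta>]
        DERIV_cmult[OF DERIV_chain2[OF DERIV_ln[OF pos] this], of "\<epsilon> * k"]]
    have "((\<lambda>\<theta>. cgf1 P \<theta> + \<epsilon> * k * ln (\<epsilon> * (x\<^sub>0 - \<theta>))) has_real_derivative
        cgf2 P \<theta> + \<epsilon> * k * (inverse (\<epsilon> * (x\<^sub>0 - \<theta>)) * - \<epsilon>)) (at \<theta>)" .
    moreover have "cgf2 P \<theta> + \<epsilon> * k * (inverse (\<epsilon> * (x\<^sub>0 - \<theta>)) * - \<epsilon>) = 0"
      unfolding g[OF \<theta>] using \<epsilon> by (auto simp: divide_inverse)
    ultimately show "((\<lambda>\<theta>. cgf1 P \<theta> + \<epsilon> * k * ln (\<epsilon> * (x\<^sub>0 - \<theta>))) has_real_derivative 0) (at \<theta> within ?I)"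
      by (metis has_field_derivative_at_within)
  qed
  then obtain C where C: "\<And>\<theta>. \<theta> \<in> ?I \<Longrightarrow> cgf1 P \<theta> + \<epsilon> * k * ln (\<epsilon> * (x\<^sub>0 - \<theta>)) = C" by blast
  have main: "ereal y \<in> mean_map P ` cgf_dom P \<and>
      variance_function M X y = k * exp (- \<epsilon> * C / k) * exp (\<epsilon> / k * y)" for y
  proof -
    \<comment> \<open>The logarithmic distance from \<open>x\<^sub>0\<close> at which the mean is
      \<open>y\<close>. It exists for every real \<open>y\<close>, so all real means occur;
      substituting it into \<open>cgf2\<close> yields the exponent
      \<open>b = \<epsilon> / k\<close>.\<close>
    define w where "w = \<epsilon> * (C - y) / k"
    define \<theta> where "\<theta> = x\<^sub>0 - \<epsilon> * exp w"
    have U: "\<epsilon> * (x\<^sub>0 - \<theta>) = exp w" using \<epsilon> by (auto simp: \<theta>_def)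
    then have \<theta>: "\<theta> \<in> ?I" using I by simp
    have "\<epsilon> * k * w = C - y" using \<epsilon> k by (auto simp: w_def)
    then have y: "cgf1 P \<theta> = y" using C[OF \<theta>] U by simp
    have "cgf2 P \<theta> = k * exp (- w)" using g[OF \<theta>] U by (simp add: exp_minus divide_inverse)
    also have "- w = - \<epsilon> * C / k + \<epsilon> / k * y" by (simp add: w_def diff_divide_distrib algebra_simps)
    finally have "cgf2 P \<theta> = k * exp (- \<epsilon> * C / k) * exp (\<epsilon> / k * y)" by (simp only: exp_add mult.assoc)
    with variance_function_interior[OF \<theta>] y int_dom[OF \<theta>] show ?thesis by (metis image_eqI)
  qed
  show ?thesis
    by (rule that[of "k * exp (- \<epsilon> * C / k)" "\<epsilon> / k"]) (use main k \<epsilon>0 in auto)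
qed

lemma self_similar_of_full_log:
  assumes full: "full_log_mean_family P a b \<theta>\<^sub>0"
  shows "self_similar_ext_1 (mean_map P ` cgf_dom P) M X"
proof -
  interpret full: full_log_mean_family P a b \<theta>\<^sub>0 by (rule full)
  have a0: "a \<noteq> 0" and b0: "b \<noteq> 0" using full.a_nz full.b_nz by auto
  obtain K where K: "\<And>\<theta>. \<theta> \<in> cgf_dom P \<Longrightarrow>
      cgf P \<theta> = (a * (\<theta>\<^sub>0 - \<theta>) * ln (a * (\<theta>\<^sub>0 - \<theta>)) - a * (\<theta>\<^sub>0 - \<theta>)) / (a * b) + K"
    using full.cgf_eq by blast
  have real_mem: "ereal y \<in> mean_map P ` cgf_dom P" for y
    using full.all_means[of y] by (metis image_eqI)
  show ?thesis
    unfolding self_similar_ext_1_def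
  proof (intro exI[of _ "\<lambda>c. ereal (ln c / b)"] allI impI conjI ballI real_mem)
    fix c :: real and \<mu> assume c: "c > 0" and "\<mu> \<in> mean_map P ` cgf_dom P"
    then obtain \<theta> where \<theta>: "\<theta> \<in> cgf_dom P" "\<mu> = mean_map P \<theta>" by blast
    \<comment> \<open>Chosen so that \<open>U \<theta>' = U \<theta> / c\<close>, which lowers
      \<open>ln U\<close> by \<open>ln c\<close> and raises the mean by
      \<open>ln c / b\<close>.\<close>
    define \<theta>' where "\<theta>' = \<theta>\<^sub>0 - a * (\<theta>\<^sub>0 - \<theta>) / c / a"
    have U': "a * (\<theta>\<^sub>0 - (\<theta>' + s)) = a * (\<theta>\<^sub>0 - (\<theta> + c * s)) / c" for s
      unfolding \<theta>'_def using a0 c by (simp add: field_simps)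
    have dom: "\<theta>' + s \<in> cgf_dom P \<longleftrightarrow> \<theta> + c * s \<in> cgf_dom P" for s
      unfolding full.dom_eq mem_Collect_eq U' using c by (simp add: zero_le_divide_iff)
    have \<theta>': "\<theta>' \<in> cgf_dom P" using dom[of 0] \<theta> by simp
    have \<mu>': "mean_map P \<theta>' = \<mu> + ereal (ln c / b)"
    proof (cases "a * (\<theta>\<^sub>0 - \<theta>) > 0")
      case True
      have e: "a * (\<theta>\<^sub>0 - \<theta>') = a * (\<theta>\<^sub>0 - \<theta>) / c" using U'[of 0] by simp
      have pos': "a * (\<theta>\<^sub>0 - \<theta>') > 0" unfolding e using True c by (rule divide_pos_pos)
      have "ln (a * (\<theta>\<^sub>0 - \<theta>')) = ln (a * (\<theta>\<^sub>0 - \<theta>)) - ln c"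
        unfolding e using True c by (rule ln_divide_pos)
      then show ?thesis
        using full.mean_map_pos[OF \<theta>(1) True] full.mean_map_pos[OF \<theta>' pos'] \<theta>(2)
        by (simp add: diff_divide_distrib)
    next
      \<comment> \<open>The member with infinite mean: the dilation fixes
        \<open>\<theta>\<^sub>0\<close>, and a finite shift does not change an infinite
        mean.\<close>
      case False
      then have "a * (\<theta>\<^sub>0 - \<theta>) = 0" using \<theta>(1) full.dom_nonneg by fastforce
      then have "\<theta> = \<theta>\<^sub>0" "\<theta>' = \<theta>\<^sub>0" using a0 by (auto simp: \<theta>'_def)
      then show ?thesis using \<theta> full.mean_map_zero by auto
    qed
    then show "\<mu> + ereal (ln c / b) \<in> mean_map P ` cgf_dom P" using \<theta>' by (metis image_eqI)
    have L: "levy_process (M \<mu>) (X \<mu>)" using levy[OF \<theta>(1)] \<theta>(2) by simp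
    have L': "levy_process (M (mean_map P \<theta>')) (X (mean_map P \<theta>'))" by (rule levy[OF \<theta>'])
    note Y = levy_process_time_scale[OF L' c]
    note Z = levy_process_affine[OF L c, of "c * (ln c / b)"]
    have "fdd_eq {0<..} (M (mean_map P \<theta>')) (\<lambda>t \<omega>. ereal (X (mean_map P \<theta>') (c * t) \<omega>))
        (M \<mu>) (\<lambda>t \<omega>. ereal (c * X \<mu> t \<omega> + c * (ln c / b) * t))"
    proof (rule fdd_eq_ereal)
      show "X (mean_map P \<theta>') (c * t) \<in> borel_measurable (M (mean_map P \<theta>'))"
        "(\<lambda>\<omega>. c * X \<mu> t \<omega> + c * (ln c / b) * t) \<in> borel_measurable (M \<mu>)" if "t \<in> {0<..}" for t
        using levy_process_measurable[OF Y, of t] levy_process_measurable[OF Z, of t] that by simp_all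
      fix T :: "real set" assume T: "finite T" "T \<subseteq> {0<..}"
      show "distr (M (mean_map P \<theta>')) (PiM T (\<lambda>_. borel)) (\<lambda>\<omega>. \<lambda>t\<in>T. X (mean_map P \<theta>') (c * t) \<omega>) =
          distr (M \<mu>) (PiM T (\<lambda>_. borel)) (\<lambda>\<omega>. \<lambda>t\<in>T. c * X \<mu> t \<omega> + c * (ln c / b) * t)"
      proof (rule levy_process_fdd_eqI[OF Y Z _ T(1)])
        show "T \<subseteq> {0..}" using T by auto
        fix t :: real assume t: "t > 0"
        then have ct: "c * t > 0" using c by simp
        let ?Q = "distr (marginal \<theta> t) borel (\<lambda>x. c * x + c * (ln c / b) * t)"
        note A = affine_marginal[where c = c and d = "c * (ln c / b) * t", OF \<theta>(1) t]
        have "marginal \<theta>' (c * t) = ?Q"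
        proof (rule real_distribution_eqI_cgf)
          show "prob_space (marginal \<theta>' (c * t))" using ct by (intro prob_space_marginal[OF \<theta>']) simp
          show "prob_space ?Q" "sets ?Q = sets borel" by (rule A)+
          show "open {s. \<theta> + c * s \<in> interior (cgf_dom P)}" "{s. \<theta> + c * s \<in> interior (cgf_dom P)} \<noteq> {}"
            by (rule dom_affine_open[OF \<theta>(1) c])+
          fix s assume "s \<in> {s. \<theta> + c * s \<in> interior (cgf_dom P)}"
          then have s: "\<theta> + c * s \<in> cgf_dom P" using int_dom by blast
          then have s': "\<theta>' + s \<in> cgf_dom P" using dom by blast
          \<comment> \<open>Under scaling, \<open>c * \<phi> (u / c)\<close> differs from
            \<open>\<phi> u\<close> only by a term linear in \<open>u\<close>, which becomes the
            drift. The value \<open>u = 0\<close> is included because \<open>\<theta>\<close> or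
            \<open>\<theta> + c * s\<close> may be the endpoint.\<close>
          define \<phi> where "\<phi> u = u * ln u - u" for u :: real
          have \<phi>: "c * \<phi> (u / c) = \<phi> u - u * ln c" if "u \<ge> 0" for u
            using that c by (cases "u = 0") (auto simp: \<phi>_def ln_div field_simps)
          define u w where "u = a * (\<theta>\<^sub>0 - \<theta>)" and "w = a * (\<theta>\<^sub>0 - (\<theta> + c * s))"
          have uw: "u \<ge> 0" "w \<ge> 0" using full.dom_nonneg[OF \<theta>(1)] full.dom_nonneg[OF s] by (auto simp: u_def w_def)
          have k: "cgf P \<theta> = \<phi> u / (a * b) + K" "cgf P (\<theta> + c * s) = \<phi> w / (a * b) + K"
            "cgf P \<theta>' = \<phi> (u / c) / (a * b) + K" "cgf P (\<theta>' + s) = \<phi> (w / c) / (a * b) + K"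
            using K[OF \<theta>(1)] K[OF s] K[OF \<theta>'] K[OF s'] U'[of 0] U'[of s] by (simp_all add: \<phi>_def u_def w_def)
          have "c * (cgf P (\<theta>' + s) - cgf P \<theta>') = (c * \<phi> (w / c) - c * \<phi> (u / c)) / (a * b)"
            unfolding k by (simp add: diff_divide_distrib right_diff_distrib)
          also have "\<dots> = (\<phi> w - \<phi> u) / (a * b) + (u - w) / a * (ln c / b)"
            unfolding \<phi>[OF uw(1)] \<phi>[OF uw(2)] using a0 b0 by (simp add: field_simps)
          also have "(u - w) / a = c * s" using a0 by (simp add: u_def w_def field_simps)
          also have "(\<phi> w - \<phi> u) / (a * b) = cgf P (\<theta> + c * s) - cgf P \<theta>"
            unfolding k by (simp add: diff_divide_distrib)
          finally have "t * (c * (cgf P (\<theta>' + s) - cgf P \<theta>')) =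
              t * (cgf P (\<theta> + c * s) - cgf P \<theta> + c * s * (ln c / b))" by (rule arg_cong)
          then have "cgf (marginal \<theta>' (c * t)) s = cgf ?Q s"
            unfolding marginal_cgf[OF \<theta>' ct s'] A(4)[OF s] by (simp add: algebra_simps)
          then show "s \<in> cgf_dom (marginal \<theta>' (c * t)) \<and> s \<in> cgf_dom ?Q \<and> cgf (marginal \<theta>' (c * t)) s = cgf ?Q s"
            using marginal_cgf_dom[OF \<theta>' ct] A(3) s s' by blast
        qed simp
        then show "distr (M (mean_map P \<theta>')) borel (X (mean_map P \<theta>') (c * t)) =
            distr (M \<mu>) borel (\<lambda>\<omega>. c * X \<mu> t \<omega> + c * (ln c / b) * t)"
          using levy_process_measurable[OF L, of t] t \<theta>(2)
          by (simp add: marginal_def distr_distr comp_def)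
      qed
    qed
    then show "fdd_eq {0<..} (M (\<mu> + ereal (ln c / b))) (\<lambda>t \<omega>. ereal (X (\<mu> + ereal (ln c / b)) (c * t) \<omega>))
        (M \<mu>) (\<lambda>t \<omega>. ereal c * (ereal (X \<mu> t \<omega>) + ereal t * ereal (ln c / b)))"
      unfolding \<mu>' by (simp add: algebra_simps)
  qed
qed

end

theorem theorem7p2:
  fixes \<Omega>' :: "ereal set"
    and M :: "ereal \<Rightarrow> 'w measure"
    and X :: "ereal \<Rightarrow> real \<Rightarrow> 'w \<Rightarrow> real"
  assumes "index_set \<Omega>'"
    and "exp_family_levy \<Omega>' M X"
    and "nondegenerate \<Omega>' M X"
  shows "(self_similar_ext_1 \<Omega>' M X \<longleftrightarrow>
            (\<exists>v>0. \<exists>b. b \<noteq> 0 \<and> hougaard_infinity_family v b \<Omega>' M X)) \<and>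
         (\<forall>v>0. \<forall>b. b \<noteq> 0 \<longrightarrow>
            (hougaard_infinity_family v b \<Omega>' M X \<longleftrightarrow>
               index_interior \<Omega>' = UNIV \<and>
               (\<forall>\<mu>. variance_function M X \<mu> = v * exp (b * \<mu>))))"
proof -
  obtain P where P: "prob_space P" "sets P = sets borel" "interior (cgf_dom P) \<noteq> {}"
    and \<Omega>: "\<Omega>' = mean_map P ` cgf_dom P"
    and X: "\<And>\<theta>. \<theta> \<in> cgf_dom P \<Longrightarrow> levy_process (M (mean_map P \<theta>)) (X (mean_map P \<theta>))"
    "\<And>\<theta>. \<theta> \<in> cgf_dom P \<Longrightarrow> distr (M (mean_map P \<theta>)) borel (X (mean_map P \<theta>) 1) = tilt P \<theta>"
    using exp_family_levyE[OF assms(2)] by metis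
  interpret levy_exp_family P M X
    by (intro levy_exp_family.intro levy_exp_family_axioms.intro P X)
  \<comment> \<open>Two distinct means, supplied by the positive reals in the index set, rule out a
    point mass.\<close>
  have two: "ereal 1 \<in> mean_map P ` cgf_dom P" "ereal 2 \<in> mean_map P ` cgf_dom P" "ereal 1 \<noteq> ereal 2"
    using assms(1) unfolding index_set_def \<Omega> by auto
  have iff: "hougaard_infinity_family v b \<Omega>' M X \<longleftrightarrow>
      (\<forall>y. ereal y \<in> \<Omega>') \<and> (\<forall>\<mu>. variance_function M X \<mu> = v * exp (b * \<mu>))"
    if "v > 0" "b \<noteq> 0" for v b
    using variance_of_hougaard[of v b \<Omega>' M X] hougaard_of_variance(1)[of v b \<Omega>'] that \<Omega> by blast
  have interior: "index_interior \<Omega>' = UNIV \<longleftrightarrow> (\<forall>y. ereal y \<in> \<Omega>')"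
    unfolding index_interior_def using interior_subset[of "{x. ereal x \<in> \<Omega>'}"] by auto
  have "self_similar_ext_1 \<Omega>' M X \<longleftrightarrow> (\<exists>v>0. \<exists>b. b \<noteq> 0 \<and> hougaard_infinity_family v b \<Omega>' M X)"
  proof
    assume "self_similar_ext_1 \<Omega>' M X"
    then show "\<exists>v>0. \<exists>b. b \<noteq> 0 \<and> hougaard_infinity_family v b \<Omega>' M X"
      using self_similar_imp_variance[OF _ two] iff unfolding \<Omega> by metis
  next
    assume "\<exists>v>0. \<exists>b. b \<noteq> 0 \<and> hougaard_infinity_family v b \<Omega>' M X"
    then obtain v b where vb: "v > 0" "b \<noteq> 0" "hougaard_infinity_family v b \<Omega>' M X" by blast
    then have "\<exists>\<theta>\<^sub>0. full_log_mean_family P (b * v) b \<theta>\<^sub>0"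
      using iff[of v b] hougaard_of_variance(2)[of v b \<Omega>'] \<Omega> by blast
    then show "self_similar_ext_1 \<Omega>' M X"
      using self_similar_of_full_log \<Omega> by blast
  qed
  then show ?thesis using iff interior by blast
qed

end
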